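(* Let $G$ be a countably infinite discrete group, let $G\curvearrowright X$ be a continuous action on a compact metrizable space $X$ with compatible metric $\rho$, preserving a Borel probability measure $\mu$, and let $\pi:(X,\mu,G)\to(Y,\nu,G)$ be a relatively mixing factor map which is not an isomorphism. Fix an integer $r\geq2$. Then there exists a constant $\delta_r>0$, depending only on the extension $\pi:(X,\mu,G)\to(Y,\nu,G)$, the metric $\rho$, and $r$, such that the following holds. For every injective sequence $\mathbf{s}=(s_i)_{i\geq1}$ in $G$, there exists a Cantor set $K_{r,\mathbf{s}}\subseteq X$ such that, for every $r$-tuple of pairwise distinct points $x_1,\ldots,x_r\in K_{r,\mathbf{s}}$, one has \[ \liminf_{i\to\infty}\ \max_{1\leq a<b\leq r}\rho(s_i x_a,s_i x_b)=0 \quad\text{and}\quad \limsup_{i\to\infty}\ \min_{1\leq a<b\leq r}\rho(s_i x_a,s_i x_b)>\delta_r . \]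
   Context: A p.m.p. $G$-system is a standard probability space with a measurable, measure-preserving action of $G$. $(Y,\nu,G)$ is a p.m.p. $G$-system. A factor map $\pi:(X,\mu,G)\to(Y,\nu,G)$ is a measurable map with $\pi_*\mu=\nu$ and, for every $g\in G$, $\pi(gx)=g\pi(x)$ for $\mu$-a.e. $x$. It is an isomorphism if there are invariant conull Borel sets $X_0\subseteq X$, $Y_0\subseteq Y$ with $\pi(X_0)=Y_0$ such that $\pi|_{X_0}:X_0\to Y_0$ is a bimeasurable $G$-equivariant bijection. All measure-theoretic objects are understood modulo null sets. With the disintegration $\mu=\int_Y\mu_y\,d\nu(y)$ over $\pi$, put $\mathbb E^X_Yf(y)=\int_X f\,d\mu_y$ for $f\in L^1(X,\mu)$, and $U_gf(x)=f(g^{-1}x)$. The notation $g\to\infty$ means that $g$ eventually leaves every finite subset of $G$. The factor map $\pi$ is relatively mixing if for all $f,h\in L^\infty(X,\mu)$ with $\mathbb E^X_Yf=\mathbb E^X_Yh=0$ one has $\|\mathbb E^X_Y(U_gf\,h)\|_{L^2(Y,\nu)}\to0$ as $g\to\infty$. A Cantor set in $X$ is a subset homeomorphic to the standard Cantor set. *)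

theory Defs
  imports "HOL-Probability.Probability" "HOL-Algebra.Group_Action"
begin

definition standard_borel :: "'a measure \<Rightarrow> bool" where
  "standard_borel M \<longleftrightarrow>
     (\<exists>T. completely_metrizable_space T \<and> separable_space T \<and> topspace T = space M \<and>
          sets M = sigma_sets (topspace T) {U. openin T U})"

text \<open>
  The acting group carries the discrete topology and will be countable, so joint measurability of
  the action is measurability of each of its maps. The locale \<^locale>\<open>group_action\<close> asks the maps
  \<open>\<alpha> g\<close> to be extensional on \<open>space M\<close>; this only fixes their irrelevant values outside the space.
\<close>

definition pmp_system ::
  "('g, 'c) monoid_scheme \<Rightarrow> 'a measure \<Rightarrow> ('g \<Rightarrow> 'a \<Rightarrow> 'a) \<Rightarrow> bool" where
  "pmp_system G M \<alpha> \<longleftrightarrow>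
     prob_space M \<and> standard_borel M \<and> group_action G (space M) \<alpha> \<and>
     (\<forall>g\<in>carrier G. \<alpha> g \<in> measurable M M \<and> distr M M (\<alpha> g) = M)"

definition factor_map ::
  "('g, 'c) monoid_scheme \<Rightarrow> 'a measure \<Rightarrow> ('g \<Rightarrow> 'a \<Rightarrow> 'a) \<Rightarrow>
   'b measure \<Rightarrow> ('g \<Rightarrow> 'b \<Rightarrow> 'b) \<Rightarrow> ('a \<Rightarrow> 'b) \<Rightarrow> bool" where
  "factor_map G \<mu> \<alpha> \<nu> \<beta> \<pi> \<longleftrightarrow>
     \<pi> \<in> measurable \<mu> \<nu> \<and> distr \<mu> \<nu> \<pi> = \<nu> \<and>
     (\<forall>g\<in>carrier G. AE x in \<mu>. \<pi> (\<alpha> g x) = \<beta> g (\<pi> x))"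

definition invariant_conull ::
  "('g, 'c) monoid_scheme \<Rightarrow> 'a measure \<Rightarrow> ('g \<Rightarrow> 'a \<Rightarrow> 'a) \<Rightarrow> 'a set \<Rightarrow> bool" where
  "invariant_conull G M \<alpha> A \<longleftrightarrow>
     A \<in> sets M \<and> (AE x in M. x \<in> A) \<and> (\<forall>g\<in>carrier G. \<alpha> g ` A = A)"

definition factor_isomorphism ::
  "('g, 'c) monoid_scheme \<Rightarrow> 'a measure \<Rightarrow> ('g \<Rightarrow> 'a \<Rightarrow> 'a) \<Rightarrow>
   'b measure \<Rightarrow> ('g \<Rightarrow> 'b \<Rightarrow> 'b) \<Rightarrow> ('a \<Rightarrow> 'b) \<Rightarrow> bool" where
  "factor_isomorphism G \<mu> \<alpha> \<nu> \<beta> \<pi> \<longleftrightarrow>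
     (\<exists>X\<^sub>0 Y\<^sub>0. invariant_conull G \<mu> \<alpha> X\<^sub>0 \<and> invariant_conull G \<nu> \<beta> Y\<^sub>0 \<and>
        bij_betw \<pi> X\<^sub>0 Y\<^sub>0 \<and>
        \<pi> \<in> measurable (restrict_space \<mu> X\<^sub>0) (restrict_space \<nu> Y\<^sub>0) \<and>
        the_inv_into X\<^sub>0 \<pi> \<in> measurable (restrict_space \<nu> Y\<^sub>0) (restrict_space \<mu> X\<^sub>0) \<and>
        (\<forall>g\<in>carrier G. \<forall>x\<in>X\<^sub>0. \<pi> (\<alpha> g x) = \<beta> g (\<pi> x)))"

text \<open>\<open>D y\<close> is the fibre measure \<open>\<mu>\<^sub>y\<close>: it is carried by the fibre over \<open>y\<close>, and \<open>\<mu> = \<integral> \<mu>\<^sub>y d\<nu>(y)\<close>.\<close>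

definition disintegration ::
  "'a measure \<Rightarrow> 'b measure \<Rightarrow> ('a \<Rightarrow> 'b) \<Rightarrow> ('b \<Rightarrow> 'a measure) \<Rightarrow> bool" where
  "disintegration \<mu> \<nu> \<pi> D \<longleftrightarrow>
     D \<in> measurable \<nu> (prob_algebra \<mu>) \<and>
     (AE y in \<nu>. emeasure (D y) (\<pi> -` {y} \<inter> space \<mu>) = 1) \<and>
     (\<forall>A\<in>sets \<mu>. emeasure \<mu> A = (\<integral>\<^sup>+ y. emeasure (D y) A \<partial>\<nu>))"

definition fibre_expectation :: "('b \<Rightarrow> 'a measure) \<Rightarrow> ('a \<Rightarrow> real) \<Rightarrow> 'b \<Rightarrow> real" where
  "fibre_expectation D f y = (\<integral>x. f x \<partial>D y)"

definition L_infinity :: "'a measure \<Rightarrow> ('a \<Rightarrow> real) set" where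
  "L_infinity M = {f \<in> borel_measurable M. \<exists>C. AE x in M. \<bar>f x\<bar> \<le> C}"

definition L2_norm :: "'b measure \<Rightarrow> ('b \<Rightarrow> real) \<Rightarrow> real" where
  "L2_norm M u = sqrt (\<integral>y. (u y)\<^sup>2 \<partial>M)"

definition translate ::
  "('g, 'c) monoid_scheme \<Rightarrow> ('g \<Rightarrow> 'a \<Rightarrow> 'a) \<Rightarrow> 'g \<Rightarrow> ('a \<Rightarrow> real) \<Rightarrow> 'a \<Rightarrow> real" where
  "translate G \<alpha> g f x = f (\<alpha> (inv\<^bsub>G\<^esub> g) x)"

text \<open>
  The limit \<open>g \<rightarrow> \<infinity>\<close> is along the filter of cofinite subsets of \<open>carrier G\<close>. On standard probability
  spaces a disintegration exists and is unique up to a \<open>\<nu>\<close>-null set, so the quantifier over \<open>D\<close>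
  only names it.
\<close>

definition relatively_mixing ::
  "('g, 'c) monoid_scheme \<Rightarrow> 'a measure \<Rightarrow> ('g \<Rightarrow> 'a \<Rightarrow> 'a) \<Rightarrow>
   'b measure \<Rightarrow> ('a \<Rightarrow> 'b) \<Rightarrow> bool" where
  "relatively_mixing G \<mu> \<alpha> \<nu> \<pi> \<longleftrightarrow>
     (\<exists>D. disintegration \<mu> \<nu> \<pi> D \<and>
        (\<forall>f\<in>L_infinity \<mu>. \<forall>h\<in>L_infinity \<mu>.
           (AE y in \<nu>. fibre_expectation D f y = 0) \<longrightarrow>
           (AE y in \<nu>. fibre_expectation D h y = 0) \<longrightarrow>
           ((\<lambda>g. L2_norm \<nu> (fibre_expectation D (\<lambda>x. translate G \<alpha> g f x * h x))) \<longlongrightarrow> 0)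
             (inf cofinite (principal (carrier G)))))"

primrec cantor_stage :: "nat \<Rightarrow> real set" where
  "cantor_stage 0 = {0..1}"
| "cantor_stage (Suc n) = (\<lambda>t. t / 3) ` cantor_stage n \<union> (\<lambda>t. (t + 2) / 3) ` cantor_stage n"

definition standard_cantor_set :: "real set" where
  "standard_cantor_set = (\<Inter>n. cantor_stage n)"

definition is_cantor_set :: "'a::topological_space set \<Rightarrow> bool" where
  "is_cantor_set K \<longleftrightarrow> K homeomorphic standard_cantor_set"

definition index_pairs :: "nat \<Rightarrow> (nat \<times> nat) set" where
  "index_pairs r = {(a, b). 1 \<le> a \<and> a < b \<and> b \<le> r}"

end

theory Submission
  imports Defs
begin

text \<open>Write \<open>D y\<close> for the measure on the fibre over \<open>y\<close>, and call \<open>support (D y)\<close> its closed support. The whole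
  Cantor set is found inside \<open>support (D y)\<close> for one well-chosen \<open>y\<close>.

  Apply relative mixing to the indicators of two sets \<open>U\<close>, \<open>V\<close>, each minus its fibrewise mean. It says that
  \<open>D y (U \<inter> g\<^sup>-\<^sup>1 V) - D y U * D y (g\<^sup>-\<^sup>1 V)\<close> tends to \<open>0\<close> in \<open>L\<^sup>2(\<nu>)\<close> as \<open>g \<rightarrow> \<infinity>\<close>. Along a subsequence of \<open>s\<close> the
  convergence is almost everywhere, and one subsequence serves all pairs from a countable base. So
  for almost every \<open>y\<close> the maps \<open>s i\<close> become independent of any fixed base set under \<open>D y\<close>: if
  \<open>D y (s\<^sub>i\<^sup>-\<^sup>1 V\<^sub>j) \<ge> c\<close> for infinitely many \<open>i\<close>, simultaneously for finitely many \<open>V\<^sub>j\<close>, then for infinitely many \<open>i\<close> every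
  prescribed tuple of open sets meeting the support contains points \<open>x\<^sub>j\<close> of the support with
  \<open>s\<^sub>i x\<^sub>j \<in> V\<^sub>j\<close> (\<open>tuple_with_prescribed_images\<close>).

  This is used with three kinds of targets. If all \<open>V\<^sub>j\<close> equal one small set, the tuples become close;
  such a set of mass at least \<open>1 / N\<close> exists by covering the space with \<open>N\<close> small sets. If the \<open>V\<^sub>j\<close> are
  separated from each other, the tuples become separated. And two disjoint targets show that the support has no
  isolated point, because an isolated point alone would have to move into both targets.

  It remains to find separated targets of mass \<open>c\<close> that are charged infinitely often. As \<open>\<pi>\<close> is not an
  isomorphism, the fibre measures are not almost all Dirac measures (\<open>dirac_fibres_imp_isomorphism\<close>), so for a set of
  positive measure of \<open>y\<close> the measure \<open>D y\<close> gives mass at least \<open>c\<close> to each of two fixed separated base sets.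
  Fibre measures are equivariant and \<open>\<nu>\<close> is invariant, so points return to such a set of positive
  measure along any sequence (\<open>recurrence\<close>). Hence by the previous paragraph a set of \<open>y\<close> of positive measure has
  perfect, in particular infinite, support. Now \<open>r\<close> points can be chosen in these supports, which gives
  \<open>r\<close> fixed separated base sets charged on a set of \<open>y\<close> of positive measure. Half of a lower
  bound for their distances is the constant \<open>\<delta>\<close>; it does not depend on the sequence \<open>s\<close>, to which recurrence is applied a second time.

  Finally the conditions on tuples are open and dense in the powers of a perfect compact set, and a
  construction of Mycielski produces a Cantor set all of whose injective tuples satisfy countably many such conditions
  (\<open>cantor_set_of_tuples\<close>).\<close>

section \<open>Cantor schemes\<close>

definition branch :: "(nat \<Rightarrow> bool) \<Rightarrow> nat \<Rightarrow> bool list" where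
  "branch b n = map b [0..<n]"

lemma length_branch [simp]: "length (branch b n) = n"
  by (simp add: branch_def)

lemma branch_0 [simp]: "branch b 0 = []"
  by (simp add: branch_def)

lemma branch_Suc: "branch b (Suc n) = branch b n @ [b n]"
  by (simp add: branch_def)

lemma branch_eq_iff: "branch b n = branch b' n \<longleftrightarrow> (\<forall>i<n. b i = b' i)"
  by (auto simp: branch_def)

text \<open>A binary tree of compact sets whose branches shrink to points. Every Cantor set below arises from
  such a tree, and comparing two trees branch by branch yields homeomorphisms.\<close>

locale cantor_scheme =
  fixes F :: "bool list \<Rightarrow> 'a::metric_space set"
  assumes compact_F: "compact (F w)"
    and nonempty: "F w \<noteq> {}"
    and nested: "F (w @ [c]) \<subseteq> F w"
    and siblings_disjoint: "F (w @ [True]) \<inter> F (w @ [False]) = {}"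
    and small: "e > 0 \<Longrightarrow> \<exists>n. \<forall>w. length w = n \<longrightarrow> (\<forall>x\<in>F w. \<forall>y\<in>F w. dist x y < e)"
begin

lemma branch_antimono: "m \<le> n \<Longrightarrow> F (branch b n) \<subseteq> F (branch b m)"
proof (induction n rule: dec_induct)
  case (step n)
  then show ?case
    using nested[of "branch b n" "b n"] by (auto simp: branch_Suc)
qed simp

lemma same_level_disjoint:
  "length w = length w' \<Longrightarrow> w \<noteq> w' \<Longrightarrow> F w \<inter> F w' = {}"
proof (induction w arbitrary: w' rule: rev_induct)
  case (snoc c w)
  obtain u d where w': "w' = u @ [d]"
    using snoc.prems(1) by (cases w' rule: rev_cases) auto
  show ?case
  proof (cases "w = u")
    case True
    then have "c \<noteq> d"
      using snoc.prems w' by auto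
    then show ?thesis
      using siblings_disjoint[of w] True w' by (cases c; cases d) auto
  next
    case False
    then have "F w \<inter> F u = {}"
      using snoc w' by auto
    then show ?thesis
      using nested[of w c] nested[of u d] w' by blast
  qed
qed auto

lemma branch_meets: "(\<Inter>n. F (branch b n)) \<noteq> {}"
proof -
  have "F [] \<inter> (\<Inter>n\<in>UNIV. F (branch b n)) \<noteq> {}"
  proof (rule compact_imp_fip_image)
    show "compact (F [])"
      by (rule compact_F)
    show "closed (F (branch b n))" for n
      by (rule compact_imp_closed[OF compact_F])
  next
    fix I :: "nat set"
    assume "finite I"
    then obtain N where N: "\<And>n. n \<in> I \<Longrightarrow> n \<le> N"
      using finite_nat_set_iff_bounded_le by auto
    obtain x where x: "x \<in> F (branch b N)"
      using nonempty by blast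
    then have "x \<in> F (branch b n)" if "n \<le> N" for n
      using branch_antimono[OF that] by blast
    moreover have "x \<in> F []"
      using calculation[of 0] by simp
    ultimately show "F [] \<inter> (\<Inter>n\<in>I. F (branch b n)) \<noteq> {}"
      using N by auto
  qed
  then show ?thesis
    by auto
qed

definition point :: "(nat \<Rightarrow> bool) \<Rightarrow> 'a" where
  "point b = (SOME x. \<forall>n. x \<in> F (branch b n))"

lemma point_in: "point b \<in> F (branch b n)"
proof -
  have "\<exists>x. \<forall>n. x \<in> F (branch b n)"
    using branch_meets[of b] by auto
  then have "\<forall>n. point b \<in> F (branch b n)"
    unfolding point_def by (rule someI_ex)
  then show ?thesis ..
qed

lemma point_unique:
  assumes "\<And>n. x \<in> F (branch b n)"
  shows "x = point b"
proof (rule ccontr)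
  assume "x \<noteq> point b"
  then obtain n where "\<forall>w. length w = n \<longrightarrow> (\<forall>u\<in>F w. \<forall>v\<in>F w. dist u v < dist x (point b))"
    using small[of "dist x (point b)"] by auto
  then have "dist x (point b) < dist x (point b)"
    using assms[of n] point_in[of b n] length_branch by blast
  then show False
    by simp
qed

lemma inj_point: "inj point"
proof (rule injI, rule ext, rule ccontr)
  fix b b' n
  assume eq: "point b = point b'" and "b n \<noteq> b' n"
  then have "branch b (Suc n) \<noteq> branch b' (Suc n)"
    by (auto simp: branch_Suc)
  then have "F (branch b (Suc n)) \<inter> F (branch b' (Suc n)) = {}"
    by (intro same_level_disjoint) simp_all
  then show False
    using point_in[of b "Suc n"] point_in[of b' "Suc n"] eq by auto
qed

lemma range_point: "range point = (\<Inter>n. \<Union>w\<in>{w. length w = n}. F w)"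
proof (intro equalityI subsetI)
  fix x
  assume "x \<in> range point"
  then obtain b where "x = point b"
    by auto
  then show "x \<in> (\<Inter>n. \<Union>w\<in>{w. length w = n}. F w)"
    using point_in[of b] length_branch by blast
next
  fix x
  assume "x \<in> (\<Inter>n. \<Union>w\<in>{w. length w = n}. F w)"
  then have "\<forall>n. \<exists>w. length w = n \<and> x \<in> F w"
    by auto
  then obtain W where len: "\<And>n. length (W n) = n" and mem: "\<And>n. x \<in> F (W n)"
    by metis
  have prefix: "W (Suc n) = W n @ [last (W (Suc n))]" for n
  proof -
    obtain u c where W: "W (Suc n) = u @ [c]"
      using len[of "Suc n"] by (cases "W (Suc n)" rule: rev_cases) auto
    have "x \<in> F u"
      using mem[of "Suc n"] nested[of u c] W by auto
    then have "F u \<inter> F (W n) \<noteq> {}"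
      using mem[of n] by blast
    moreover have "length u = length (W n)"
      using len[of "Suc n"] len[of n] W by simp
    ultimately have "u = W n"
      using same_level_disjoint by blast
    then show ?thesis
      using W by simp
  qed
  have "branch (\<lambda>n. last (W (Suc n))) n = W n" for n
  proof (induction n)
    case 0
    show ?case
      using len[of 0] by simp
  next
    case (Suc n)
    then show ?case
      using prefix[of n, symmetric] by (simp add: branch_Suc)
  qed
  then show "x \<in> range point"
    using mem point_unique[of x "\<lambda>n. last (W (Suc n))"] by auto
qed

text \<open>Each level splits the limit set into finitely many relatively open pieces, since a point of
  one compact piece keeps a positive distance from the union of the others.\<close>

lemma near_points_share_branch:
  "\<exists>e>0. \<forall>b'. dist (point b) (point b') < e \<longrightarrow> branch b' n = branch b n"
proof -
  define Z where "Z = (\<Union>w\<in>{w. length w = n \<and> w \<noteq> branch b n}. F w)"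
  have "{w :: bool list. length w = n \<and> w \<noteq> branch b n} \<subseteq> {w. set w \<subseteq> UNIV \<and> length w = n}"
    by auto
  then have "finite {w :: bool list. length w = n \<and> w \<noteq> branch b n}"
    by (rule finite_subset) (rule finite_lists_length_eq, simp)
  then have "closed Z"
    unfolding Z_def by (intro closed_UN) (auto intro: compact_imp_closed compact_F)
  moreover have "point b \<notin> Z"
  proof
    assume "point b \<in> Z"
    then obtain w where w: "length w = n" "w \<noteq> branch b n" "point b \<in> F w"
      unfolding Z_def by auto
    have "F w \<inter> F (branch b n) = {}"
      by (rule same_level_disjoint) (use w in auto)
    then show False
      using w point_in[of b n] by blast
  qed
  ultimately have "open (- Z)" "point b \<in> - Z"
    by auto
  then obtain e where e: "e > 0" "\<And>x. dist x (point b) < e \<Longrightarrow> x \<in> - Z"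
    unfolding open_dist by blast
  have "branch b' n = branch b n" if "dist (point b) (point b') < e" for b'
  proof (rule ccontr)
    assume "branch b' n \<noteq> branch b n"
    then have "point b' \<in> Z"
      unfolding Z_def using point_in[of b' n] by (auto intro!: exI[of _ "branch b' n"])
    then show False
      using e(2)[of "point b'"] that by (simp add: dist_commute)
  qed
  with e(1) show ?thesis
    by blast
qed

end

text \<open>Two schemes are compared by matching points with the same branch. Near points of the first limit set agree
  on a long initial part of the branch, so their images lie in one small piece of the second scheme.\<close>

lemma cantor_scheme_transport_continuous:
  assumes "cantor_scheme F" and "cantor_scheme H"
  shows "continuous_on (range (cantor_scheme.point F))
           (\<lambda>x. cantor_scheme.point H (inv_into UNIV (cantor_scheme.point F) x))"
proof -
  interpret F: cantor_scheme F by fact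
  interpret H: cantor_scheme H by fact
  show ?thesis
    unfolding continuous_on_iff
  proof (intro ballI allI impI)
    fix x and e :: real
    assume "x \<in> range F.point" and e: "e > 0"
    then obtain b where b: "x = F.point b"
      by auto
    obtain n where n: "\<forall>w. length w = n \<longrightarrow> (\<forall>x\<in>H w. \<forall>y\<in>H w. dist x y < e)"
      using H.small[OF e] by auto
    obtain d where d: "d > 0" "\<And>b'. dist (F.point b) (F.point b') < d \<Longrightarrow> branch b' n = branch b n"
      using F.near_points_share_branch by blast
    have "dist (H.point b') (H.point b) < e" if "dist (F.point b') (F.point b) < d" for b'
    proof -
      have "branch b' n = branch b n"
        using d(2) that by (simp add: dist_commute)
      then have "H.point b' \<in> H (branch b n)"
        using H.point_in[of b' n] by simp
      then show ?thesis
        using n[rule_format, OF length_branch] H.point_in[of b n] by blast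
    qed
    then show "\<exists>d>0. \<forall>x'\<in>range F.point. dist x' x < d \<longrightarrow>
        dist (H.point (inv_into UNIV F.point x')) (H.point (inv_into UNIV F.point x)) < e"
      using d(1) b F.inj_point by auto
  qed
qed

lemma cantor_schemes_homeomorphic:
  assumes "cantor_scheme F" and "cantor_scheme H"
  shows "range (cantor_scheme.point F) homeomorphic range (cantor_scheme.point H)"
proof -
  interpret F: cantor_scheme F by fact
  interpret H: cantor_scheme H by fact
  have "homeomorphism (range F.point) (range H.point)
      (\<lambda>x. H.point (inv_into UNIV F.point x)) (\<lambda>x. F.point (inv_into UNIV H.point x))"
    unfolding homeomorphism_def image_image
  proof (intro conjI)
    show "continuous_on (range F.point) (\<lambda>x. H.point (inv_into UNIV F.point x))"
      by (rule cantor_scheme_transport_continuous[OF assms])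
    show "continuous_on (range H.point) (\<lambda>x. F.point (inv_into UNIV H.point x))"
      by (rule cantor_scheme_transport_continuous[OF assms(2,1)])
    show "\<forall>x\<in>range F.point. F.point (inv_into UNIV H.point (H.point (inv_into UNIV F.point x))) = x"
      using F.inj_point H.inj_point by simp
    show "\<forall>y\<in>range H.point. H.point (inv_into UNIV F.point (F.point (inv_into UNIV H.point y))) = y"
      using F.inj_point H.inj_point by simp
    show "range (\<lambda>b. H.point (inv_into UNIV F.point (F.point b))) = range H.point"
      using F.inj_point by (simp add: inv_f_f)
    show "range (\<lambda>b. F.point (inv_into UNIV H.point (H.point b))) = range F.point"
      using H.inj_point by (simp add: inv_f_f)
  qed
  then show ?thesis
    unfolding homeomorphic_def by blast
qed

text \<open>The head of the word selects the coarsest third, in agreement with the recursion of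
  \<^const>\<open>cantor_stage\<close>; letters appended at the end subdivide further.\<close>

primrec ternary_interval :: "bool list \<Rightarrow> real set" where
  "ternary_interval [] = {0..1}"
| "ternary_interval (c # w) = (\<lambda>t. (t + (if c then 2 else 0)) / 3) ` ternary_interval w"

lemma ternary_interval_snoc_subset: "ternary_interval (w @ [c]) \<subseteq> ternary_interval w"
proof (induction w)
  case Nil
  show ?case
    by (cases c; auto simp only: append_Nil ternary_interval.simps atLeastAtMost_iff if_True if_False; simp)
next
  case (Cons d w)
  then show ?case
    by (simp only: append_Cons ternary_interval.simps) (rule image_mono)
qed

lemma ternary_interval_siblings: "ternary_interval (w @ [True]) \<inter> ternary_interval (w @ [False]) = {}"
proof (induction w)
  case Nil
  have "(s + 2) / 3 \<noteq> (t + 0) / 3" if "s \<in> {0..1}" "t \<in> {0..1}" for s t :: real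
    using that by simp
  then show ?case
    unfolding append_Nil ternary_interval.simps if_True if_False by blast
next
  case (Cons c w)
  have "inj (\<lambda>t::real. (t + (if c then 2 else 0)) / 3)"
    by (auto intro!: injI)
  from image_Int[OF this, symmetric] Cons show ?case
    by (simp only: append_Cons ternary_interval.simps image_empty)
qed

lemma ternary_interval_diameter:
  "x \<in> ternary_interval w \<Longrightarrow> y \<in> ternary_interval w \<Longrightarrow> dist x y \<le> (1 / 3) ^ length w"
proof (induction w arbitrary: x y)
  case (Cons c w)
  then obtain s t where st: "s \<in> ternary_interval w" "t \<in> ternary_interval w"
    "x = (s + (if c then 2 else 0)) / 3" "y = (t + (if c then 2 else 0)) / 3"
    by auto
  have "\<bar>(s + a) / 3 - (t + a) / 3\<bar> = \<bar>s - t\<bar> / 3" for a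
    by (simp flip: diff_divide_distrib)
  then have "dist x y = dist s t / 3"
    unfolding st dist_real_def .
  then show ?case
    using Cons.IH[OF st(1,2)] by simp
qed (auto simp: dist_real_def)

interpretation ternary: cantor_scheme ternary_interval
proof
  fix w :: "bool list" and c :: bool and e :: real
  show "compact (ternary_interval w)"
  proof (induction w)
    case (Cons c w)
    have "continuous_on (ternary_interval w) (\<lambda>t. (t + (if c then 2 else 0)) / 3)"
      by (intro continuous_intros) simp
    then show ?case
      unfolding ternary_interval.simps using Cons by (rule compact_continuous_image)
  qed simp
  show "ternary_interval w \<noteq> {}"
    by (induction w) simp_all
  show "ternary_interval (w @ [c]) \<subseteq> ternary_interval w"
    by (rule ternary_interval_snoc_subset)
  show "ternary_interval (w @ [True]) \<inter> ternary_interval (w @ [False]) = {}"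
    by (rule ternary_interval_siblings)
  assume "e > 0"
  then obtain n where n: "(1 / 3 :: real) ^ n < e"
    using real_arch_pow_inv[of e "1 / 3"] by auto
  have "dist x y < e" if "length w = n" "x \<in> ternary_interval w" "y \<in> ternary_interval w" for w x y
    using ternary_interval_diameter[OF that(2,3)] that(1) n by simp
  then show "\<exists>n. \<forall>w. length w = n \<longrightarrow>
      (\<forall>x\<in>ternary_interval w. \<forall>y\<in>ternary_interval w. dist x y < e)"
    by blast
qed

lemma standard_cantor_set_eq: "standard_cantor_set = range ternary.point"
proof -
  have "cantor_stage n = (\<Union>w\<in>{w. length w = n}. ternary_interval w)" for n
  proof (induction n)
    case (Suc n)
    have split: "{w :: bool list. length w = Suc n} =
        (#) False ` {w. length w = n} \<union> (#) True ` {w. length w = n}"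
      by (auto simp: length_Suc_conv)
    have "(\<lambda>t. t / 3) ` cantor_stage n = (\<Union>w\<in>(#) False ` {w. length w = n}. ternary_interval w)"
      unfolding Suc image_UN by simp
    moreover have "(\<lambda>t. (t + 2) / 3) ` cantor_stage n = (\<Union>w\<in>(#) True ` {w. length w = n}. ternary_interval w)"
      unfolding Suc image_UN by simp
    ultimately show ?case
      unfolding cantor_stage.simps split UN_Un by (rule arg_cong2)
  qed simp
  then show ?thesis
    unfolding standard_cantor_set_def ternary.range_point by simp
qed

lemma (in cantor_scheme) is_cantor_set_range_point: "is_cantor_set (range point)"
  unfolding is_cantor_set_def standard_cantor_set_eq
  by (rule cantor_schemes_homeomorphic) unfold_locales

section \<open>Cantor sets of tuples satisfying open dense conditions\<close>

text \<open>The setting of Mycielski's theorem: countably many conditions on \<open>J\<close>-tuples from a perfect compact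
  set \<open>C\<close>, each open, and each dense in the sense that any tuple from \<open>C\<close> can be perturbed within \<open>C\<close> to satisfy it.\<close>

locale dense_open_conditions =
  fixes C :: "'a::metric_space set" and J :: "'i set" and R :: "nat \<Rightarrow> ('i \<Rightarrow> 'a) \<Rightarrow> bool"
  assumes compact_C: "compact C" and nonempty_C: "C \<noteq> {}"
    and perfect: "p \<in> C \<Longrightarrow> p islimpt C"
    and finite_J: "finite J"
    and R_open: "R n x \<Longrightarrow> \<exists>e>0. \<forall>x'. (\<forall>j\<in>J. dist (x' j) (x j) < e) \<longrightarrow> R n x'"
    and R_dense: "e > 0 \<Longrightarrow> (\<And>j. j \<in> J \<Longrightarrow> x j \<in> C) \<Longrightarrow>
      \<exists>x'. (\<forall>j\<in>J. x' j \<in> C \<and> dist (x' j) (x j) < e) \<and> R n x'"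
begin

text \<open>One level of the tree under construction. Only words of length \<open>n\<close> matter.\<close>

definition admissible :: "nat \<Rightarrow> (bool list \<Rightarrow> 'a set) \<Rightarrow> bool" where
  "admissible n U \<longleftrightarrow> (\<forall>w. length w = n \<longrightarrow> open (U w) \<and> U w \<inter> C \<noteq> {})"

text \<open>By density some tuple of \<open>C\<close> in the sets \<open>U (v j)\<close> satisfies the condition, and by openness so do all
  tuples near it. Injectivity of \<open>v\<close> is what allows the sets to be shrunk around
  the coordinates independently of each other.\<close>

lemma shrink_to_condition:
  assumes U: "admissible n U" and v: "inj_on v J" "\<And>j. j \<in> J \<Longrightarrow> length (v j) = n"
  shows "\<exists>U'. admissible n U' \<and> (\<forall>w. U' w \<subseteq> U w) \<and>
    (\<forall>x. (\<forall>j\<in>J. x j \<in> U' (v j)) \<longrightarrow> R m x)"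
proof -
  have "\<forall>j\<in>J. \<exists>x. x \<in> U (v j) \<inter> C"
    using U v(2) unfolding admissible_def by blast
  then obtain x where x: "\<And>j. j \<in> J \<Longrightarrow> x j \<in> U (v j) \<inter> C"
    by metis
  have "\<forall>j\<in>J. \<exists>e>0. ball (x j) e \<subseteq> U (v j)"
    using U v(2) x unfolding admissible_def by (meson IntD1 open_contains_ball)
  then obtain e where e: "\<And>j. j \<in> J \<Longrightarrow> e j > 0" "\<And>j. j \<in> J \<Longrightarrow> ball (x j) (e j) \<subseteq> U (v j)"
    by metis
  define e0 where "e0 = Min (insert 1 (e ` J))"
  have e0: "e0 > 0" "\<And>j. j \<in> J \<Longrightarrow> e0 \<le> e j"
    using finite_J e(1) unfolding e0_def by (auto intro!: Min_le)
  have xC: "\<And>j. j \<in> J \<Longrightarrow> x j \<in> C"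
    using x by blast
  obtain x' where x': "\<forall>j\<in>J. x' j \<in> C \<and> dist (x' j) (x j) < e0" and Rx': "R m x'"
    using R_dense[of e0 x m, OF e0(1) xC] by blast
  obtain d where d: "d > 0" "\<And>z. (\<forall>j\<in>J. dist (z j) (x' j) < d) \<Longrightarrow> R m z"
    using R_open[OF Rx'] by blast
  define U' where "U' w = (if w \<in> v ` J then U w \<inter> ball (x' (inv_into J v w)) d else U w)" for w
  have U'v: "U' (v j) = U (v j) \<inter> ball (x' j) d" if "j \<in> J" for j
    using that v(1) by (simp add: U'_def)
  have "x' j \<in> U' (v j) \<inter> C" if "j \<in> J" for j
  proof -
    have "x' j \<in> ball (x j) (e j)"
      using x' that e0(2)[OF that] by (force simp: dist_commute)
    then show ?thesis
      using U'v[OF that] e(2)[OF that] x' that d(1) by auto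
  qed
  then have meets: "U' (v j) \<inter> C \<noteq> {}" if "j \<in> J" for j
    using that by blast
  have "admissible n U'"
    unfolding admissible_def
  proof (intro allI impI conjI)
    fix w :: "bool list"
    assume len: "length w = n"
    then show "open (U' w)"
      using U by (auto simp: U'_def admissible_def)
    show "U' w \<inter> C \<noteq> {}"
    proof (cases "w \<in> v ` J")
      case True
      then show ?thesis
        using meets by blast
    next
      case False
      then have "U' w = U w"
        by (simp add: U'_def)
      then show ?thesis
        using U len by (simp add: admissible_def)
    qed
  qed
  moreover have "R m z" if "\<forall>j\<in>J. z j \<in> U' (v j)" for z
    using that U'v by (intro d(2)) (auto simp: dist_commute)
  moreover have "\<forall>w. U' w \<subseteq> U w"
    by (simp add: U'_def)
  ultimately show ?thesis
    by blast
qed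

text \<open>A condition already achieved survives further shrinking, so finitely many can be treated in turn.\<close>

lemma shrink_to_conditions:
  assumes "finite Q" and "admissible n U"
    and "\<And>m v. (m, v) \<in> Q \<Longrightarrow> inj_on v J \<and> (\<forall>j\<in>J. length (v j) = n)"
  shows "\<exists>U'. admissible n U' \<and> (\<forall>w. U' w \<subseteq> U w) \<and>
    (\<forall>(m, v)\<in>Q. \<forall>x. (\<forall>j\<in>J. x j \<in> U' (v j)) \<longrightarrow> R m x)"
  using assms(1,3)
proof (induction Q)
  case empty
  show ?case
    using assms(2) by blast
next
  case (insert q Q)
  obtain m v where q: "q = (m, v)"
    by (cases q)
  have "\<exists>U'. admissible n U' \<and> (\<forall>w. U' w \<subseteq> U w) \<and>
      (\<forall>(m, v)\<in>Q. \<forall>x. (\<forall>j\<in>J. x j \<in> U' (v j)) \<longrightarrow> R m x)"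
    by (rule insert.IH) (use insert.prems in blast)
  then obtain U1 where U1: "admissible n U1" "\<forall>w. U1 w \<subseteq> U w"
      "\<forall>(m, v)\<in>Q. \<forall>x. (\<forall>j\<in>J. x j \<in> U1 (v j)) \<longrightarrow> R m x"
    by blast
  have v: "inj_on v J" "\<And>j. j \<in> J \<Longrightarrow> length (v j) = n"
    using insert.prems[of m v] q by auto
  obtain U2 where U2: "admissible n U2" "\<forall>w. U2 w \<subseteq> U1 w"
      "\<forall>x. (\<forall>j\<in>J. x j \<in> U2 (v j)) \<longrightarrow> R m x"
    using shrink_to_condition[OF U1(1) v] by blast
  have old: "\<forall>(m, v)\<in>Q. \<forall>x. (\<forall>j\<in>J. x j \<in> U2 (v j)) \<longrightarrow> R m x"
  proof (clarify)
    fix m' v' x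
    assume "(m', v') \<in> Q" "\<forall>j\<in>J. x j \<in> U2 (v' j)"
    then have "(\<forall>j\<in>J. x j \<in> U1 (v' j))"
      using U2(2) by blast
    then show "R m' x"
      using U1(3) \<open>(m', v') \<in> Q\<close> by blast
  qed
  show ?case
  proof (intro exI conjI)
    show "admissible n U2" by fact
    show "\<forall>w. U2 w \<subseteq> U w"
      using U1(2) U2(2) by blast
    show "\<forall>(m, v)\<in>insert q Q. \<forall>x. (\<forall>j\<in>J. x j \<in> U2 (v j)) \<longrightarrow> R m x"
      using old U2(3) q by simp
  qed
qed

text \<open>Perfectness makes each set of the tree split in two.\<close>

lemma two_small_balls:
  assumes "open U" and "U \<inter> C \<noteq> {}" and "e > 0"
  shows "\<exists>p d. d > 0 \<and> d \<le> e \<and> (\<forall>c. p c \<in> C \<and> cball (p c) d \<subseteq> U) \<and>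
    cball (p True) d \<inter> cball (p False) d = {}"
proof -
  obtain a where a: "a \<in> U" "a \<in> C"
    using assms(2) by blast
  obtain b where b: "b \<in> U" "b \<in> C" "b \<noteq> a"
    using perfect[OF a(2)] a(1) assms(1) unfolding islimpt_def by blast
  have "\<exists>e>0. cball x e \<subseteq> U" if "x \<in> U" for x
    using assms(1) that unfolding open_contains_cball by simp
  from this[OF a(1)] this[OF b(1)]
  obtain d1 d2 where d: "d1 > 0" "cball a d1 \<subseteq> U" "d2 > 0" "cball b d2 \<subseteq> U"
    by metis
  define d where "d = min (min e (dist a b / 3)) (min d1 d2)"
  have "d > 0" "d \<le> e" "d \<le> d1" "d \<le> d2" and d3: "3 * d \<le> dist a b"
    using assms(3) d b(3) by (auto simp: d_def min_def)
  have "cball a d \<inter> cball b d = {}"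
  proof -
    have False if "dist a z \<le> d" "dist b z \<le> d" for z
      using dist_triangle2[of a b z] that d3 \<open>d > 0\<close> by linarith
    then show ?thesis
      by auto
  qed
  moreover have "cball a d \<subseteq> U" "cball b d \<subseteq> U"
    using d(2,4) subset_cball[OF \<open>d \<le> d1\<close>, of a] subset_cball[OF \<open>d \<le> d2\<close>, of b] by simp_all
  ultimately show ?thesis
    using \<open>d > 0\<close> \<open>d \<le> e\<close> a(2) b(2)
    by (intro exI[of _ "\<lambda>c. if c then a else b"] exI[of _ d]) simp
qed

definition refines :: "nat \<Rightarrow> (bool list \<Rightarrow> 'a set) \<Rightarrow> (bool list \<Rightarrow> 'a set) \<Rightarrow> bool" where
  "refines n U U' \<longleftrightarrow>
     (\<forall>w c. length w = n \<longrightarrow> closure (U' (w @ [c])) \<subseteq> U w) \<and>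
     (\<forall>w. length w = n \<longrightarrow> closure (U' (w @ [True])) \<inter> closure (U' (w @ [False])) = {}) \<and>
     (\<forall>w. length w = Suc n \<longrightarrow>
        (\<forall>x\<in>closure (U' w). \<forall>y\<in>closure (U' w). dist x y \<le> 2 / real (Suc n))) \<and>
     (\<forall>m\<le>n. \<forall>v. inj_on v J \<longrightarrow> (\<forall>j\<in>J. length (v j) = Suc n) \<longrightarrow>
        (\<forall>x. (\<forall>j\<in>J. x j \<in> U' (v j)) \<longrightarrow> R m x))"

lemma refinesD:
  assumes "refines n U U'"
  shows refines_closure: "length w = n \<Longrightarrow> closure (U' (w @ [c])) \<subseteq> U w"
    and refines_disjoint:
      "length w = n \<Longrightarrow> closure (U' (w @ [True])) \<inter> closure (U' (w @ [False])) = {}"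
    and refines_diameter:
      "length w = Suc n \<Longrightarrow> x \<in> closure (U' w) \<Longrightarrow> y \<in> closure (U' w) \<Longrightarrow> dist x y \<le> 2 / real (Suc n)"
    and refines_condition:
      "m \<le> n \<Longrightarrow> inj_on v J \<Longrightarrow> (\<And>j. j \<in> J \<Longrightarrow> length (v j) = Suc n) \<Longrightarrow>
        (\<And>j. j \<in> J \<Longrightarrow> z j \<in> U' (v j)) \<Longrightarrow> R m z"
  using assms unfolding refines_def by simp_all

text \<open>First each set is replaced by two small disjoint balls, which settles all requirements on closures and diameters
  for good; then the finitely many conditions indexed by \<open>m \<le> n\<close> and injective tuples of words are
  imposed by shrinking.\<close>

lemma refinement_exists:
  assumes U: "admissible n U"
  shows "\<exists>U'. admissible (Suc n) U' \<and> refines n U U'"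
proof -
  have "\<forall>w. \<exists>p d. length w = n \<longrightarrow> d > 0 \<and> d \<le> 1 / real (Suc n) \<and>
      (\<forall>c. p c \<in> C \<and> cball (p c) d \<subseteq> U w) \<and> cball (p True) d \<inter> cball (p False) d = {}"
    using two_small_balls[of "U _" "1 / real (Suc n)"] U unfolding admissible_def by simp
  then obtain p d where pd: "\<And>w. length w = n \<Longrightarrow> d w > 0 \<and> d w \<le> 1 / real (Suc n) \<and>
      (\<forall>c. p w c \<in> C \<and> cball (p w c) (d w) \<subseteq> U w) \<and>
      cball (p w True) (d w) \<inter> cball (p w False) (d w) = {}"
    by metis
  define U0 where "U0 u = ball (p (butlast u) (last u)) (d (butlast u))" for u
  have "admissible (Suc n) U0"
    unfolding admissible_def
  proof (intro allI impI conjI)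
    fix u :: "bool list"
    assume "length u = Suc n"
    then have "length (butlast u) = n"
      by simp
    from pd[OF this] have "p (butlast u) (last u) \<in> U0 u \<inter> C"
      by (simp add: U0_def)
    then show "U0 u \<inter> C \<noteq> {}"
      by blast
  qed (simp add: U0_def)
  \<comment> \<open>Tuples of words are taken extensional on \<open>J\<close> so that there are finitely many of them.\<close>
  define Q where "Q = {..n} \<times> {v \<in> J \<rightarrow>\<^sub>E {w :: bool list. length w = Suc n}. inj_on v J}"
  have "finite {w :: bool list. length w = Suc n}"
    using finite_lists_length_eq[of "UNIV :: bool set" "Suc n"] by simp
  then have "finite (J \<rightarrow>\<^sub>E {w :: bool list. length w = Suc n})"
    using finite_J by (intro finite_PiE)
  then have "finite Q"
    unfolding Q_def by (intro finite_cartesian_product finite_atMost) simp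
  moreover have "inj_on v J \<and> (\<forall>j\<in>J. length (v j) = Suc n)" if "(m, v) \<in> Q" for m v
    using that by (auto simp: Q_def)
  ultimately obtain U' where U': "admissible (Suc n) U'" "\<forall>w. U' w \<subseteq> U0 w"
      "\<forall>(m, v)\<in>Q. \<forall>x. (\<forall>j\<in>J. x j \<in> U' (v j)) \<longrightarrow> R m x"
    using shrink_to_conditions[OF _ \<open>admissible (Suc n) U0\<close>, of Q] by blast
  have closure_U': "closure (U' (w @ [c])) \<subseteq> cball (p w c) (d w)" for w c
  proof (rule closure_minimal)
    show "U' (w @ [c]) \<subseteq> cball (p w c) (d w)"
      using U'(2)[rule_format, of "w @ [c]"] ball_subset_cball by (auto simp: U0_def)
  qed simp
  have "refines n U U'"
    unfolding refines_def
  proof (intro conjI allI impI ballI)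
    fix w :: "bool list" and c
    assume w: "length w = n"
    show "closure (U' (w @ [c])) \<subseteq> U w"
      using closure_U'[of w c] pd[OF w] by blast
    show "closure (U' (w @ [True])) \<inter> closure (U' (w @ [False])) = {}"
      using closure_U'[of w True] closure_U'[of w False] pd[OF w] by blast
  next
    fix u :: "bool list" and x y
    assume u: "length u = Suc n" and xy: "x \<in> closure (U' u)" "y \<in> closure (U' u)"
    obtain w c where wc: "u = w @ [c]" "length w = n"
      using u by (cases u rule: rev_cases) auto
    then have "dist (p w c) x \<le> d w" "dist (p w c) y \<le> d w"
      using xy closure_U'[of w c] by auto
    then have "dist x y \<le> 2 * d w"
      using dist_triangle3[of x y "p w c"] by linarith
    also have "\<dots> \<le> 2 / real (Suc n)"
      using pd[OF wc(2)] by simp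
    finally show "dist x y \<le> 2 / real (Suc n)" .
  next
    fix m v and x :: "'i \<Rightarrow> 'a"
    assume m: "m \<le> n" and v: "inj_on v J" "\<forall>j\<in>J. length (v j) = Suc n"
      and x: "\<forall>j\<in>J. x j \<in> U' (v j)"
    have "inj_on (restrict v J) J"
      using v(1) by (simp add: inj_on_def)
    then have "(m, restrict v J) \<in> Q"
      using m v(2) by (auto simp: Q_def)
    with U'(3) have "(\<forall>j\<in>J. x j \<in> U' (restrict v J j)) \<longrightarrow> R m x"
      by blast
    then show "R m x"
      using x by simp
  qed
  with U'(1) show ?thesis
    by blast
qed

text \<open>An injective tuple of points has pairwise distinct words from some level on, and beyond level \<open>m\<close> every tuple
  with distinct words satisfies condition \<open>m\<close>.\<close>

proposition cantor_set_of_tuples: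
  "\<exists>K\<subseteq>C. is_cantor_set K \<and> (\<forall>x. inj_on x J \<and> x ` J \<subseteq> K \<longrightarrow> (\<forall>m. R m x))"
proof -
  have "\<exists>U. \<forall>n. admissible n (U n) \<and> refines n (U n) (U (Suc n))"
  proof (rule dependent_nat_choice)
    show "\<exists>U. admissible 0 U"
      using nonempty_C by (intro exI[of _ "\<lambda>w. UNIV"]) (simp add: admissible_def)
  qed (rule refinement_exists)
  then obtain U where adm: "\<And>n. admissible n (U n)"
    and ref: "\<And>n. refines n (U n) (U (Suc n))"
    by blast
  define F where "F w = closure (U (length w) w) \<inter> C" for w
  have closure_sub: "closure (U (Suc (length w)) (w @ [c])) \<subseteq> U (length w) w" for w c
    using ref by (rule refines_closure) simp
  interpret cantor_scheme F
  proof
    fix w :: "bool list" and c and e :: real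
    show "compact (F w)"
      unfolding F_def by (intro closed_Int_compact compact_C) simp
    have "U (length w) w \<inter> C \<noteq> {}"
      using adm unfolding admissible_def by blast
    then show "F w \<noteq> {}"
      unfolding F_def using closure_subset by blast
    show "F (w @ [c]) \<subseteq> F w"
      using closure_sub[of w c] closure_subset[of "U (length w) w"] by (auto simp: F_def)
    have "closure (U (Suc (length w)) (w @ [True])) \<inter> closure (U (Suc (length w)) (w @ [False])) = {}"
      using ref by (rule refines_disjoint) simp
    then show "F (w @ [True]) \<inter> F (w @ [False]) = {}"
      by (auto simp: F_def)
    assume e: "e > 0"
    then obtain n where n: "2 / e < real n"
      using reals_Archimedean2 by blast
    then have "2 / real (Suc n) < e"
      using e by (simp add: field_simps)
    moreover have "dist x y \<le> 2 / real (Suc n)" if "length w = Suc n" "x \<in> F w" "y \<in> F w" for w x y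
      using ref by (rule refines_diameter) (use that in \<open>auto simp: F_def\<close>)
    ultimately show "\<exists>n. \<forall>w. length w = n \<longrightarrow> (\<forall>x\<in>F w. \<forall>y\<in>F w. dist x y < e)"
      by (intro exI[of _ "Suc n"]) (blast intro: le_less_trans)
  qed
  have "R m x" if x: "inj_on x J" "x ` J \<subseteq> range point" for x m
  proof -
    have "\<forall>j\<in>J. \<exists>b. x j = point b"
      using x(2) by blast
    then obtain b where b: "\<And>j. j \<in> J \<Longrightarrow> x j = point (b j)"
      by metis
    have "\<exists>k. b i k \<noteq> b j k" if "i \<in> J" "j \<in> J" "i \<noteq> j" for i j
    proof (rule ccontr)
      assume "\<not> ?thesis"
      then have "b i = b j"
        by (simp add: fun_eq_iff)
      then have "x i = x j"
        using b that(1,2) by simp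
      then show False
        using x(1) that by (simp add: inj_on_eq_iff)
    qed
    then obtain k where k: "\<And>i j. i \<in> J \<Longrightarrow> j \<in> J \<Longrightarrow> i \<noteq> j \<Longrightarrow> b i (k i j) \<noteq> b j (k i j)"
      by metis
    \<comment> \<open>A level beyond \<open>m\<close> at which all branches of the tuple have separated.\<close>
    define n where "n = Max (insert m ((\<lambda>(i, j). k i j) ` (J \<times> J)))"
    have fin: "finite (insert m ((\<lambda>(i, j). k i j) ` (J \<times> J)))"
      using finite_J by simp
    then have "m \<le> n"
      unfolding n_def by (intro Max_ge) auto
    have kn: "k i j \<le> n" if "i \<in> J" "j \<in> J" for i j
      unfolding n_def using fin that by (intro Max_ge) auto
    define v where "v j = branch (b j) (Suc n)" for j
    have "inj_on v J"
    proof (rule inj_onI, rule ccontr)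
      fix i j
      assume ij: "i \<in> J" "j \<in> J" "v i = v j" "i \<noteq> j"
      then have "b i (k i j) = b j (k i j)"
        using kn[OF ij(1,2)] by (simp add: v_def branch_eq_iff)
      then show False
        using k[OF ij(1,2,4)] by simp
    qed
    moreover have "x j \<in> U (Suc n) (v j)" if "j \<in> J" for j
    proof -
      have "x j \<in> F (v j @ [b j (Suc n)])"
        using point_in[of "b j" "Suc (Suc n)"] b[OF that] by (simp add: v_def branch_Suc[of _ "Suc n"])
      then show ?thesis
        using closure_sub[of "v j" "b j (Suc n)"] by (auto simp: F_def v_def)
    qed
    ultimately show "R m x"
      using \<open>m \<le> n\<close> by (intro refines_condition[OF ref[of n], of m v]) (simp_all add: v_def)
  qed
  moreover have "range point \<subseteq> C"
    using point_in[of _ 0] by (auto simp: F_def)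
  ultimately show ?thesis
    using is_cantor_set_range_point by blast
qed

end

section \<open>Supports and asymptotically independent maps\<close>

lemma compact_metric_countable_base:
  assumes "compact (UNIV :: 'x::metric_space set)"
  shows "\<exists>\<B> :: 'x set set. countable \<B> \<and> (\<forall>V\<in>\<B>. open V) \<and>
    (\<forall>U x. open U \<longrightarrow> x \<in> U \<longrightarrow> (\<exists>V\<in>\<B>. x \<in> V \<and> V \<subseteq> U))"
proof -
  have "\<exists>A :: 'x set. finite A \<and> UNIV \<subseteq> (\<Union>a\<in>A. ball a (1 / real (Suc n)))" for n
    using assms unfolding compact_eq_totally_bounded by simp
  then obtain A :: "nat \<Rightarrow> 'x set" where fin: "\<And>n. finite (A n)"
    and cover: "\<And>n. UNIV \<subseteq> (\<Union>a\<in>A n. ball a (1 / real (Suc n)))"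
    by metis
  define \<B> where "\<B> = (\<Union>n. (\<lambda>a. ball a (1 / real (Suc n))) ` A n)"
  have "countable \<B>"
    unfolding \<B>_def using fin by (intro countable_UN countableI_type countable_finite finite_imageI)
  moreover have "\<forall>V\<in>\<B>. open V"
    by (auto simp: \<B>_def)
  moreover have "\<exists>V\<in>\<B>. x \<in> V \<and> V \<subseteq> U" if U: "open U" "x \<in> U" for U x
  proof -
    obtain e where e: "e > 0" "ball x e \<subseteq> U"
      using U unfolding open_contains_ball by blast
    obtain n where "2 / e < real n"
      using reals_Archimedean2 by blast
    then have n: "2 / real (Suc n) < e"
      using e(1) by (simp add: field_simps)
    obtain a where a: "a \<in> A n" "x \<in> ball a (1 / real (Suc n))"
      using cover[of n] by blast
    have "ball a (1 / real (Suc n)) \<subseteq> ball x e"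
    proof
      fix z
      assume "z \<in> ball a (1 / real (Suc n))"
      then have "dist x z < 1 / real (Suc n) + 1 / real (Suc n)"
        using a(2) dist_triangle3[of x z a] by simp
      also have "\<dots> = 2 / real (Suc n)"
        by simp
      finally show "z \<in> ball x e"
        using n by simp
    qed
    then show ?thesis
      using a e(2) unfolding \<B>_def by blast
  qed
  ultimately show ?thesis
    by blast
qed

definition support :: "'x::topological_space measure \<Rightarrow> 'x set" where
  "support m = {x. \<forall>U. open U \<longrightarrow> x \<in> U \<longrightarrow> measure m U > 0}"

lemma supportD: "x \<in> support m \<Longrightarrow> open U \<Longrightarrow> x \<in> U \<Longrightarrow> measure m U > 0"
  by (simp add: support_def)

lemma closed_support: "closed (support m)"
  unfolding closed_def
proof (subst open_subopen, rule ballI)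
  fix x
  assume "x \<in> - support m"
  then obtain U where U: "open U" "x \<in> U" "\<not> measure m U > 0"
    by (auto simp: support_def)
  then have "U \<subseteq> - support m"
    by (auto simp: support_def)
  then show "\<exists>U. open U \<and> x \<in> U \<and> U \<subseteq> - support m"
    using U by blast
qed

locale borel_prob_base = prob_space m for m :: "'x::metric_space measure" +
  fixes \<B> :: "'x set set"
  assumes sets_m: "sets m = sets borel"
    and compact_space: "compact (UNIV :: 'x set)"
    and countable_base: "countable \<B>"
    and base_open: "V \<in> \<B> \<Longrightarrow> open V"
    and base_nbhd: "open U \<Longrightarrow> x \<in> U \<Longrightarrow> \<exists>V\<in>\<B>. x \<in> V \<and> V \<subseteq> U"
begin

lemma space_m: "space m = UNIV"
  using sets_eq_imp_space_eq[OF sets_m] by simp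

text \<open>The complement is a countable union of null base sets; a countable base is needed because arbitrary unions
  of null open sets are not controlled by the measure.\<close>

lemma complement_support_null: "- support m \<in> null_sets m"
proof -
  have "- support m = (\<Union>V\<in>{V \<in> \<B>. measure m V = 0}. V)"
  proof (intro equalityI subsetI)
    fix x
    assume "x \<in> - support m"
    then obtain U where U: "open U" "x \<in> U" "\<not> measure m U > 0"
      by (auto simp: support_def)
    obtain V where V: "V \<in> \<B>" "x \<in> V" "V \<subseteq> U"
      using base_nbhd[OF U(1,2)] by blast
    have "measure m V \<le> measure m U"
      by (rule finite_measure_mono) (use V U sets_m in auto)
    then have "measure m V = 0"
      using U(3) measure_nonneg[of m V] by linarith
    then show "x \<in> (\<Union>V\<in>{V \<in> \<B>. measure m V = 0}. V)"
      using V by blast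
  qed (use base_open supportD in fastforce)
  moreover have "(\<Union>V\<in>{V \<in> \<B>. measure m V = 0}. V) \<in> null_sets m"
  proof (rule null_sets_UN')
    show "countable {V \<in> \<B>. measure m V = 0}"
      using countable_base by simp
  qed (auto simp: null_sets_def emeasure_eq_measure sets_m base_open)
  ultimately show ?thesis
    by simp
qed

lemma meets_support:
  assumes "A \<in> sets borel" and "measure m A > 0"
  shows "A \<inter> support m \<noteq> {}"
proof
  assume "A \<inter> support m = {}"
  then have "A \<subseteq> - support m"
    by auto
  then have "A \<in> null_sets m"
    using null_sets_subset[OF complement_support_null] assms(1) sets_m by simp
  then show False
    using assms(2) by (auto simp: null_sets_def emeasure_eq_measure)
qed

lemma support_nonempty: "support m \<noteq> {}"
  using meets_support[of UNIV] prob_space space_m by simp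

lemma support_singleton_dirac:
  assumes "support m \<subseteq> {x}"
  shows "measure m {x} = 1"
proof -
  have "measure m (- {x}) = 0"
  proof (rule ccontr)
    assume "measure m (- {x}) \<noteq> 0"
    then have "- {x} \<inter> support m \<noteq> {}"
      by (intro meets_support) (auto simp: zero_less_measure_iff)
    then show False
      using assms by auto
  qed
  then show ?thesis
    using prob_compl[of "{x}"] by (simp add: sets_m space_m Compl_eq_Diff_UNIV)
qed

text \<open>Cover the space by finitely many small base sets. For each \<open>k\<close> one of their preimages has mass at least
  the reciprocal of their number, and by the pigeonhole principle one set works for infinitely many \<open>k\<close>.\<close>

lemma small_base_set_with_mass:
  fixes T :: "nat \<Rightarrow> 'x \<Rightarrow> 'x"
  assumes T: "\<And>k. T k \<in> borel_measurable borel" and "e > 0"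
  shows "\<exists>V\<in>\<B>. \<exists>c>0. (\<forall>x\<in>V. \<forall>y\<in>V. dist x y < e) \<and>
    (\<exists>\<^sub>F k in sequentially. measure m (T k -` V) \<ge> c)"
proof -
  have "\<forall>x. \<exists>V\<in>\<B>. x \<in> V \<and> V \<subseteq> ball x (e / 2)"
    using base_nbhd[of "ball _ (e / 2)"] assms(2) by simp
  then obtain W where W: "\<And>x. W x \<in> \<B>" "\<And>x. x \<in> W x" "\<And>x. W x \<subseteq> ball x (e / 2)"
    by metis
  obtain A where A: "finite A" "UNIV \<subseteq> (\<Union>x\<in>A. W x)"
    using compactE_image[OF compact_space, of UNIV W] W base_open by (metis UNIV_I UN_I subsetI)
  have "A \<noteq> {}"
    using A(2) by auto
  then have c: "1 / real (card A) > 0"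
    using A(1) by (simp add: card_gt_0_iff)
  have "\<exists>x\<in>A. measure m (T k -` W x) \<ge> 1 / real (card A)" for k
  proof (rule ccontr)
    assume "\<not> ?thesis"
    then have less: "\<And>x. x \<in> A \<Longrightarrow> measure m (T k -` W x) < 1 / real (card A)"
      by force
    have meas: "T k -` W x \<in> sets m" for x
      using measurable_sets[OF T, of "W x"] base_open[OF W(1)] sets_m by simp
    have "1 = measure m (\<Union>x\<in>A. T k -` W x)"
    proof -
      have "(\<Union>x\<in>A. T k -` W x) = space m"
        using A(2) unfolding space_m by blast
      then show ?thesis
        by (simp add: prob_space)
    qed
    also have "\<dots> \<le> (\<Sum>x\<in>A. measure m (T k -` W x))"
      using A(1) meas by (intro finite_measure_subadditive_finite) auto
    also have "\<dots> < (\<Sum>x\<in>A. 1 / real (card A))"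
      using less A(1) \<open>A \<noteq> {}\<close> by (intro sum_strict_mono) auto
    also have "\<dots> = 1"
      using A(1) \<open>A \<noteq> {}\<close> by simp
    finally show False
      by simp
  qed
  then have "\<exists>\<^sub>F k in sequentially. \<exists>x\<in>A. measure m (T k -` W x) \<ge> 1 / real (card A)"
    by simp
  then have "\<exists>x\<in>A. \<exists>\<^sub>F k in sequentially. measure m (T k -` W x) \<ge> 1 / real (card A)"
    unfolding frequently_bex_finite_distrib[OF A(1)] .
  then obtain x where "x \<in> A" "\<exists>\<^sub>F k in sequentially. measure m (T k -` W x) \<ge> 1 / real (card A)"
    by blast
  moreover have "dist u v < e" if "u \<in> W x" "v \<in> W x" for u v
  proof -
    have "dist x u < e / 2" "dist x v < e / 2"
      using W(3)[of x] that by auto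
    then show ?thesis
      using dist_triangle3[of u v x] by linarith
  qed
  ultimately show ?thesis
    using W(1) c by (intro bexI[of _ "W x"] exI[of _ "1 / real (card A)"]) auto
qed

end

lemma finite_strict_margin:
  fixes f :: "'p \<Rightarrow> real"
  assumes "finite P" and "\<And>p. p \<in> P \<Longrightarrow> f p < c"
  shows "\<exists>\<eta>>0. \<forall>p\<in>P. f p + \<eta> \<le> c"
proof (cases "P = {}")
  case False
  then have "Max (f ` P) < c"
    using assms by simp
  then show ?thesis
    using assms(1) by (intro exI[of _ "c - Max (f ` P)"]) (auto simp: Max_ge)
qed (auto intro: exI[of _ 1])

text \<open>The only property of a typical fibre measure \<open>m\<close> and of the group elements \<open>T k\<close> that enters the
  construction of the Cantor set: in the limit, where \<open>T k\<close> sends a point is independent of the region from which the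
  point comes.\<close>

locale asymptotically_independent = borel_prob_base m \<B>
  for m :: "'x::metric_space measure" and \<B> +
  fixes T :: "nat \<Rightarrow> 'x \<Rightarrow> 'x"
  assumes T_continuous: "continuous_on UNIV (T k)"
    and independence: "U \<in> \<B> \<Longrightarrow> V \<in> \<B> \<Longrightarrow>
      (\<lambda>k. measure m (U \<inter> T k -` V) - measure m U * measure m (T k -` V)) \<longlonglongrightarrow> 0"
begin

lemma T_measurable: "T k \<in> borel_measurable borel"
  using T_continuous by (rule borel_measurable_continuous_onI)

lemma T_preimage_sets: "open V \<Longrightarrow> T k -` V \<in> sets borel"
  using T_continuous by (simp add: open_vimage)

text \<open>If \<open>W \<subseteq> U j\<close> is a base set meeting the support, then \<open>W \<inter> T k -` V j\<close> has mass close to the product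
  \<open>m W * m (T k -` V j)\<close>, which is at least \<open>m W * c\<close>; so it has positive mass and meets the support.\<close>

lemma tuple_with_prescribed_images:
  assumes "finite J" and V: "\<And>j. j \<in> J \<Longrightarrow> V j \<in> \<B>" and "c > 0"
    and mass: "\<exists>\<^sub>F k in sequentially. \<forall>j\<in>J. measure m (T k -` V j) \<ge> c"
    and U: "\<And>j. j \<in> J \<Longrightarrow> open (U j)" "\<And>j. j \<in> J \<Longrightarrow> U j \<inter> support m \<noteq> {}"
  shows "\<exists>\<^sub>F k in sequentially. \<exists>x. \<forall>j\<in>J. x j \<in> U j \<inter> support m \<and> T k (x j) \<in> V j"
proof -
  have "\<exists>W. W \<in> \<B> \<and> W \<subseteq> U j \<and> measure m W > 0" if j: "j \<in> J" for j
  proof -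
    obtain x where x: "x \<in> U j" "x \<in> support m"
      using U(2)[OF j] by blast
    obtain W where W: "W \<in> \<B>" "x \<in> W" "W \<subseteq> U j"
      using base_nbhd[OF U(1)[OF j] x(1)] by blast
    have "measure m W > 0"
      using x(2) base_open[OF W(1)] W(2) by (rule supportD)
    then show ?thesis
      using W by blast
  qed
  then obtain W where W: "\<And>j. j \<in> J \<Longrightarrow> W j \<in> \<B>" "\<And>j. j \<in> J \<Longrightarrow> W j \<subseteq> U j"
      "\<And>j. j \<in> J \<Longrightarrow> measure m (W j) > 0"
    by metis
  have "\<forall>\<^sub>F k in sequentially. \<forall>j\<in>J.
      \<bar>measure m (W j \<inter> T k -` V j) - measure m (W j) * measure m (T k -` V j)\<bar> < measure m (W j) * c"
  proof (rule eventually_ball_finite[OF assms(1)], rule ballI)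
    fix j
    assume j: "j \<in> J"
    have "measure m (W j) * c > 0"
      using W(3)[OF j] assms(3) by simp
    then show "\<forall>\<^sub>F k in sequentially.
        \<bar>measure m (W j \<inter> T k -` V j) - measure m (W j) * measure m (T k -` V j)\<bar> < measure m (W j) * c"
      using order_tendstoD(2)[OF tendsto_rabs_zero[OF independence[OF W(1)[OF j] V[OF j]]]] by simp
  qed
  from frequently_eventually_frequently[OF mass this] show ?thesis
  proof (rule frequently_elim1)
    fix k
    assume k: "(\<forall>j\<in>J. c \<le> measure m (T k -` V j)) \<and> (\<forall>j\<in>J.
      \<bar>measure m (W j \<inter> T k -` V j) - measure m (W j) * measure m (T k -` V j)\<bar> < measure m (W j) * c)"
    have "\<exists>x. x \<in> U j \<inter> support m \<and> T k x \<in> V j" if j: "j \<in> J" for j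
    proof -
      have "measure m (W j) * c \<le> measure m (W j) * measure m (T k -` V j)"
        using k j W(3)[OF j] by (intro mult_left_mono) auto
      moreover have "\<bar>measure m (W j \<inter> T k -` V j) - measure m (W j) * measure m (T k -` V j)\<bar>
          < measure m (W j) * c"
        using k j by blast
      ultimately have "measure m (W j \<inter> T k -` V j) > 0"
        by linarith
      moreover have "W j \<inter> T k -` V j \<in> sets borel"
        using base_open[OF W(1)[OF j]] T_preimage_sets[OF base_open[OF V[OF j]]] by simp
      ultimately have "(W j \<inter> T k -` V j) \<inter> support m \<noteq> {}"
        by (intro meets_support)
      then show ?thesis
        using W(2)[OF j] by blast
    qed
    then show "\<exists>x. \<forall>j\<in>J. x j \<in> U j \<inter> support m \<and> T k (x j) \<in> V j"
      by metis
  qed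
qed

text \<open>A neighbourhood of \<open>x\<close> contains points of the support that are sent at the same time into two disjoint targets,
  hence two different points.\<close>

lemma support_perfect:
  assumes V: "V True \<in> \<B>" "V False \<in> \<B>" "V True \<inter> V False = {}" and "c > 0"
    and mass: "\<exists>\<^sub>F k in sequentially. \<forall>b. measure m (T k -` V b) \<ge> c"
    and x: "x \<in> support m"
  shows "x islimpt support m"
  unfolding islimpt_def
proof (intro allI impI)
  fix U
  assume U: "x \<in> U" "open U"
  have VB: "V b \<in> \<B>" for b
    using V by (cases b) auto
  have "\<exists>\<^sub>F k in sequentially. \<exists>z. \<forall>b\<in>UNIV. z b \<in> U \<inter> support m \<and> T k (z b) \<in> V b"
    by (rule tuple_with_prescribed_images[where c = c]) (use VB assms U in auto)
  then obtain k z where z: "\<And>b. z b \<in> U \<inter> support m" "\<And>b. T k (z b) \<in> V b"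
    using frequently_ex by fastforce
  have "z True \<noteq> z False"
    using z(2)[of True] z(2)[of False] V(3) by auto
  then show "\<exists>y\<in>support m. y \<in> U \<and> y \<noteq> x"
    using z(1) by (metis IntD1 IntD2)
qed

definition close_at :: "'i set \<Rightarrow> real \<Rightarrow> nat \<Rightarrow> ('i \<Rightarrow> 'x) \<Rightarrow> bool" where
  "close_at J e k x \<longleftrightarrow> (\<forall>i\<in>J. \<forall>j\<in>J. dist (T k (x i)) (T k (x j)) < e)"

definition apart_at :: "'i set \<Rightarrow> real \<Rightarrow> nat \<Rightarrow> ('i \<Rightarrow> 'x) \<Rightarrow> bool" where
  "apart_at J d k x \<longleftrightarrow> (\<forall>i\<in>J. \<forall>j\<in>J. i \<noteq> j \<longrightarrow> dist (T k (x i)) (T k (x j)) > d)"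

lemma T_uniform:
  assumes "\<eta> > 0"
  shows "\<exists>e>0. \<forall>x x'. (\<forall>j\<in>J. dist (x' j) (x j) < e) \<longrightarrow>
    (\<forall>i\<in>J. \<forall>j\<in>J. \<bar>dist (T k (x' i)) (T k (x' j)) - dist (T k (x i)) (T k (x j))\<bar> < \<eta>)"
proof -
  have "uniformly_continuous_on UNIV (T k)"
    using T_continuous compact_space by (rule compact_uniformly_continuous)
  then obtain e where e: "e > 0" "\<And>u v. dist u v < e \<Longrightarrow> dist (T k u) (T k v) < \<eta> / 2"
    unfolding uniformly_continuous_on_def using assms by (metis UNIV_I half_gt_zero)
  have "\<bar>dist (T k (x' i)) (T k (x' j)) - dist (T k (x i)) (T k (x j))\<bar> < \<eta>"
    if "\<forall>j\<in>J. dist (x' j) (x j) < e" "i \<in> J" "j \<in> J" for x x' :: "'a \<Rightarrow> 'x" and i j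
  proof -
    have "dist (T k (x' i)) (T k (x i)) < \<eta> / 2" "dist (T k (x' j)) (T k (x j)) < \<eta> / 2"
      using that e(2) by auto
    then show ?thesis
      using abs_dist_diff_le dist_triangle[of "T k (x' i)" "T k (x' j)" "T k (x i)"]
        dist_triangle[of "T k (x i)" "T k (x' j)" "T k (x j)"]
        dist_triangle[of "T k (x i)" "T k (x j)" "T k (x' i)"]
        dist_triangle[of "T k (x' i)" "T k (x j)" "T k (x' j)"]
      by (simp add: dist_commute abs_if)
  qed
  then show ?thesis
    using e(1) by blast
qed

lemma close_at_open:
  assumes "finite J" and "close_at J c k x"
  shows "\<exists>e>0. \<forall>x'. (\<forall>j\<in>J. dist (x' j) (x j) < e) \<longrightarrow> close_at J c k x'"
proof -
  obtain \<eta> where \<eta>: "\<eta> > 0" "\<forall>p\<in>J \<times> J. dist (T k (x (fst p))) (T k (x (snd p))) + \<eta> \<le> c"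
    using finite_strict_margin[of "J \<times> J" "\<lambda>p. dist (T k (x (fst p))) (T k (x (snd p)))" c] assms
    by (auto simp: close_at_def)
  obtain e where e: "e > 0" "\<And>x x' i j. (\<forall>j\<in>J. dist (x' j) (x j) < e) \<Longrightarrow> i \<in> J \<Longrightarrow> j \<in> J \<Longrightarrow>
      \<bar>dist (T k (x' i)) (T k (x' j)) - dist (T k (x i)) (T k (x j))\<bar> < \<eta>"
    using T_uniform[OF \<eta>(1), of J k] by blast
  have "dist (T k (x' i)) (T k (x' j)) < c" if "\<forall>j\<in>J. dist (x' j) (x j) < e" "i \<in> J" "j \<in> J" for x' i j
    using e(2)[of x' x i j, OF that] \<eta>(2)[rule_format, of "(i, j)"] that by simp
  then show ?thesis
    using e(1) unfolding close_at_def by blast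
qed

lemma apart_at_open:
  assumes "finite J" and "apart_at J c k x"
  shows "\<exists>e>0. \<forall>x'. (\<forall>j\<in>J. dist (x' j) (x j) < e) \<longrightarrow> apart_at J c k x'"
proof -
  define P where "P = {p \<in> J \<times> J. fst p \<noteq> snd p}"
  have "\<exists>\<eta>>0. \<forall>p\<in>P. - dist (T k (x (fst p))) (T k (x (snd p))) + \<eta> \<le> - c"
    by (rule finite_strict_margin) (use assms in \<open>auto simp: P_def apart_at_def\<close>)
  then obtain \<eta> where \<eta>: "\<eta> > 0" "\<forall>p\<in>P. - dist (T k (x (fst p))) (T k (x (snd p))) + \<eta> \<le> - c"
    by blast
  obtain e where e: "e > 0" "\<And>x x' i j. (\<forall>j\<in>J. dist (x' j) (x j) < e) \<Longrightarrow> i \<in> J \<Longrightarrow> j \<in> J \<Longrightarrow>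
      \<bar>dist (T k (x' i)) (T k (x' j)) - dist (T k (x i)) (T k (x j))\<bar> < \<eta>"
    using T_uniform[OF \<eta>(1), of J k] by blast
  have "dist (T k (x' i)) (T k (x' j)) > c"
    if "\<forall>j\<in>J. dist (x' j) (x j) < e" "i \<in> J" "j \<in> J" "i \<noteq> j" for x' i j
    using e(2)[of x' x i j, OF that(1-3)] \<eta>(2)[rule_format, of "(i, j)"] that by (simp add: P_def)
  then show ?thesis
    using e(1) unfolding apart_at_def by blast
qed

text \<open>Both being close and being apart at some late time are open conditions on tuples. They are dense in the support
  by the choice of suitable targets: a single small set with recurring mass, or the given separated sets \<open>V j\<close>.\<close>

proposition cantor_set_close_and_apart:
  assumes J: "finite J" and V: "\<And>j. j \<in> J \<Longrightarrow> V j \<in> \<B>" and "c > 0"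
    and mass: "\<exists>\<^sub>F k in sequentially. \<forall>j\<in>J. measure m (T k -` V j) \<ge> c"
    and sep: "\<And>i j u v. i \<in> J \<Longrightarrow> j \<in> J \<Longrightarrow> i \<noteq> j \<Longrightarrow> u \<in> V i \<Longrightarrow> v \<in> V j \<Longrightarrow> dist u v > d"
    and perfect: "\<And>x. x \<in> support m \<Longrightarrow> x islimpt support m"
  shows "\<exists>K. is_cantor_set K \<and> (\<forall>x. inj_on x J \<and> x ` J \<subseteq> K \<longrightarrow>
    (\<forall>e>0. \<exists>\<^sub>F k in sequentially. close_at J e k x) \<and> (\<exists>\<^sub>F k in sequentially. apart_at J d k x))"
proof -
  \<comment> \<open>The two families of conditions are interleaved, both demanding a time not before \<open>n\<close>.\<close>
  define R where "R n x \<longleftrightarrow> (if even n then \<exists>k\<ge>n. close_at J (1 / real (Suc n)) k x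
    else \<exists>k\<ge>n. apart_at J d k x)" for n x
  interpret dense_open_conditions "support m" J R
  proof
    show "compact (support m)"
      using compact_space closed_support compact_Int_closed by fastforce
    show "support m \<noteq> {}"
      by (rule support_nonempty)
    show "finite J"
      by (rule J)
  next
    fix n x
    assume "R n x"
    then show "\<exists>e>0. \<forall>x'. (\<forall>j\<in>J. dist (x' j) (x j) < e) \<longrightarrow> R n x'"
      using close_at_open[OF J, of "1 / real (Suc n)" _ x] apart_at_open[OF J, of d _ x]
      unfolding R_def by (cases "even n") (simp, meson)+
  next
    fix e :: real and x :: "'a \<Rightarrow> 'x" and n
    assume e: "e > 0" and x: "\<And>j. j \<in> J \<Longrightarrow> x j \<in> support m"
    have meets: "ball (x j) e \<inter> support m \<noteq> {}" if "j \<in> J" for j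
      using x[OF that] e by (auto simp: disjoint_iff intro!: exI[of _ "x j"])
    have images: "\<exists>k\<ge>n. \<exists>z. (\<forall>j\<in>J. z j \<in> support m \<and> dist (z j) (x j) < e) \<and> (\<forall>j\<in>J. T k (z j) \<in> W j)"
      if W: "\<And>j. j \<in> J \<Longrightarrow> W j \<in> \<B>" and "a > 0"
        and "\<exists>\<^sub>F k in sequentially. \<forall>j\<in>J. measure m (T k -` W j) \<ge> a" for W a
    proof -
      have "\<exists>\<^sub>F k in sequentially. \<exists>z. \<forall>j\<in>J. z j \<in> ball (x j) e \<inter> support m \<and> T k (z j) \<in> W j"
        by (rule tuple_with_prescribed_images[OF J W that(2,3)]) (use meets in auto)
      then obtain k where "k \<ge> n" "\<exists>z. \<forall>j\<in>J. z j \<in> ball (x j) e \<inter> support m \<and> T k (z j) \<in> W j"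
        unfolding frequently_sequentially by blast
      then show ?thesis
        by (auto simp: dist_commute)
    qed
    show "\<exists>x'. (\<forall>j\<in>J. x' j \<in> support m \<and> dist (x' j) (x j) < e) \<and> R n x'"
    proof (cases "even n")
      case True
      obtain W a where W: "W \<in> \<B>" "a > 0" "\<forall>u\<in>W. \<forall>v\<in>W. dist u v < 1 / real (Suc n)"
          "\<exists>\<^sub>F k in sequentially. measure m (T k -` W) \<ge> a"
        using small_base_set_with_mass[of T "1 / real (Suc n)"] T_measurable by auto
      have "\<exists>\<^sub>F k in sequentially. \<forall>j\<in>J. measure m (T k -` W) \<ge> a"
        using W(4) by (rule frequently_elim1) simp
      from images[of "\<lambda>j. W", OF W(1,2) this] obtain k z where kz: "k \<ge> n"
          "\<forall>j\<in>J. z j \<in> support m \<and> dist (z j) (x j) < e" "\<forall>j\<in>J. T k (z j) \<in> W"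
        by blast
      have "close_at J (1 / real (Suc n)) k z"
        unfolding close_at_def using kz(3) W(3) by blast
      then have "R n z"
        using kz(1) True by (auto simp: R_def)
      then show ?thesis
        using kz(2) by blast
    next
      case False
      from images[of V, OF V assms(3) mass] obtain k z where kz: "k \<ge> n"
          "\<forall>j\<in>J. z j \<in> support m \<and> dist (z j) (x j) < e" "\<forall>j\<in>J. T k (z j) \<in> V j"
        by blast
      have "apart_at J d k z"
        unfolding apart_at_def using kz(3) sep by blast
      then have "R n z"
        using kz(1) False by (auto simp: R_def)
      then show ?thesis
        using kz(2) by blast
    qed
  qed (rule perfect)
  obtain K where K: "is_cantor_set K" "\<And>x m. inj_on x J \<and> x ` J \<subseteq> K \<Longrightarrow> R m x"
    using cantor_set_of_tuples by blast
  have "(\<forall>e>0. \<exists>\<^sub>F k in sequentially. close_at J e k x) \<and> (\<exists>\<^sub>F k in sequentially. apart_at J d k x)"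
    if x: "inj_on x J \<and> x ` J \<subseteq> K" for x
  proof (intro conjI allI impI)
    fix e :: real
    assume "e > 0"
    show "\<exists>\<^sub>F k in sequentially. close_at J e k x"
      unfolding frequently_sequentially
    proof
      fix N
      obtain n where "1 / e < real n"
        using reals_Archimedean2 by blast
      define n' where "n' = 2 * max n N"
      have "1 / e < real (Suc n')"
        using \<open>1 / e < real n\<close> by (simp add: n'_def)
      then have "1 / real (Suc n') < e"
        using \<open>e > 0\<close> by (simp add: field_simps)
      moreover obtain k where "k \<ge> n'" "close_at J (1 / real (Suc n')) k x"
        using K(2)[OF x, of n'] by (auto simp: R_def n'_def)
      ultimately show "\<exists>k\<ge>N. close_at J e k x"
        unfolding close_at_def n'_def by (intro exI[of _ k]) force
    qed
  next
    show "\<exists>\<^sub>F k in sequentially. apart_at J d k x"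
      unfolding frequently_sequentially
    proof
      fix N
      show "\<exists>k\<ge>N. apart_at J d k x"
      proof -
        obtain k where "k \<ge> 2 * N + 1" "apart_at J d k x"
          using K(2)[OF x, of "2 * N + 1"] by (auto simp: R_def)
        then show ?thesis
          by (intro exI[of _ k]) simp
      qed
    qed
  qed
  with K(1) show ?thesis
    by blast
qed

end

section \<open>Almost everywhere convergence along a common subsequence\<close>

text \<open>The sum of the sequences with geometric weights still tends to \<open>0\<close> in \<open>L\<^sup>1\<close>, and it
  dominates a multiple of each of them, so a subsequence along which the sum converges almost everywhere
  serves all of them at once.\<close>

lemma (in finite_measure) common_AE_subsequence:
  fixes f :: "'i \<Rightarrow> nat \<Rightarrow> 'a \<Rightarrow> real"
  assumes I: "countable I"
    and meas: "\<And>i n. i \<in> I \<Longrightarrow> f i n \<in> borel_measurable M"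
    and bound: "\<And>i n x. i \<in> I \<Longrightarrow> x \<in> space M \<Longrightarrow> 0 \<le> f i n x \<and> f i n x \<le> 1"
    and lim: "\<And>i. i \<in> I \<Longrightarrow> (\<lambda>n. \<integral>x. f i n x \<partial>M) \<longlonglongrightarrow> 0"
  shows "\<exists>r. strict_mono r \<and> (AE x in M. \<forall>i\<in>I. (\<lambda>n. f i (r n) x) \<longlonglongrightarrow> 0)"
proof (cases "I = {}")
  case True
  then show ?thesis
    by (intro exI[of _ id]) (simp add: strict_mono_def)
next
  case False
  define e where "e = from_nat_into I"
  have e: "e j \<in> I" for j
    unfolding e_def by (rule from_nat_into[OF False])
  have e_surj: "\<exists>j. e j = i" if "i \<in> I" for i
    unfolding e_def by (metis I from_nat_into_surj that)
  define t where "t j n x = (1 / 2) ^ j * f (e j) n x" for j n x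
  have t_meas: "t j n \<in> borel_measurable M" for j n
    unfolding t_def using meas[OF e] by measurable
  have t_bound: "0 \<le> t j n x \<and> t j n x \<le> (1 / 2) ^ j" if "x \<in> space M" for j n x
    unfolding t_def using bound[OF e that, of j n] by (simp add: mult_left_le)
  have geometric: "summable (\<lambda>j. (1 / 2 :: real) ^ j)"
    by (rule summable_geometric) simp
  have t_summable: "summable (\<lambda>j. t j n x)" if "x \<in> space M" for n x
    by (rule summable_comparison_test'[OF geometric, of 0]) (use t_bound[OF that] in auto)
  have t_integrable: "integrable M (t j n)" for j n
    by (rule integrable_const_bound[where B = "(1 / 2) ^ j"]) (use t_bound t_meas in auto)
  have t_int_bound: "0 \<le> (\<integral>x. t j n x \<partial>M) \<and> (\<integral>x. t j n x \<partial>M) \<le> (1 / 2) ^ j * measure M (space M)" for j n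
  proof
    show "0 \<le> (\<integral>x. t j n x \<partial>M)"
      by (rule Bochner_Integration.integral_nonneg) (use t_bound in auto)
    have "(\<integral>x. t j n x \<partial>M) \<le> (\<integral>x. (1 / 2) ^ j \<partial>M)"
      by (rule integral_mono) (use t_bound t_integrable in auto)
    then show "(\<integral>x. t j n x \<partial>M) \<le> (1 / 2) ^ j * measure M (space M)"
      by (simp add: mult.commute)
  qed
  define h where "h n x = (\<Sum>j. t j n x)" for n x
  have abs_sum: "summable (\<lambda>j. \<integral>x. norm (t j n x) \<partial>M)" for n
  proof (rule summable_comparison_test'[OF summable_mult2[OF geometric, of "measure M (space M)"], of 0])
    fix j
    have "(\<integral>x. norm (t j n x) \<partial>M) = (\<integral>x. t j n x \<partial>M)"
      by (rule Bochner_Integration.integral_cong) (use t_bound in auto)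
    then show "norm (\<integral>x. norm (t j n x) \<partial>M) \<le> (1 / 2) ^ j * measure M (space M)"
      using t_int_bound[of j n] by simp
  qed
  have norm_sum: "AE x in M. summable (\<lambda>j. norm (t j n x))" for n
  proof (rule AE_I2)
    fix x
    assume "x \<in> space M"
    then have "(\<lambda>j. norm (t j n x)) = (\<lambda>j. t j n x)"
      using t_bound by auto
    then show "summable (\<lambda>j. norm (t j n x))"
      using t_summable[OF \<open>x \<in> space M\<close>] by simp
  qed
  have h_integrable: "integrable M (h n)"
    and h_integral: "(\<integral>x. h n x \<partial>M) = (\<Sum>j. \<integral>x. t j n x \<partial>M)" for n
    unfolding h_def using integrable_suminf[OF t_integrable norm_sum abs_sum]
      integral_suminf[OF t_integrable norm_sum abs_sum] by auto
  have h_nonneg: "0 \<le> h n x" if "x \<in> space M" for n x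
    unfolding h_def by (rule suminf_nonneg[OF t_summable[OF that]]) (use t_bound[OF that] in auto)
  have "(\<lambda>n. \<Sum>j. \<integral>x. t j n x \<partial>M) \<longlonglongrightarrow> (\<Sum>j. 0)"
  proof (rule tannerys_theorem[THEN conjunct2, THEN conjunct2])
    show "(\<lambda>n. \<integral>x. t j n x \<partial>M) \<longlonglongrightarrow> 0" for j
      unfolding t_def using tendsto_mult_right_zero[OF lim[OF e[of j]], of "(1 / 2) ^ j"] by simp
    show "\<forall>\<^sub>F (j, n) in sequentially \<times>\<^sub>F sequentially.
        norm (\<integral>x. t j n x \<partial>M) \<le> (1 / 2) ^ j * measure M (space M)"
      using t_int_bound by (intro always_eventually) auto
  qed (use summable_mult2[OF geometric] in auto)
  then have "(\<lambda>n. \<integral>x. h n x \<partial>M) \<longlonglongrightarrow> 0"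
    by (simp add: h_integral)
  moreover have "(\<integral>x. norm (h n x) \<partial>M) = (\<integral>x. h n x \<partial>M)" for n
    by (rule Bochner_Integration.integral_cong) (use h_nonneg in auto)
  ultimately obtain r where r: "strict_mono r" "AE x in M. (\<lambda>n. h (r n) x) \<longlonglongrightarrow> 0"
    using tendsto_L1_AE_subseq[of M h, OF h_integrable] by auto
  have "AE x in M. \<forall>i\<in>I. (\<lambda>n. f i (r n) x) \<longlonglongrightarrow> 0"
    using r(2) AE_space
  proof eventually_elim
    case (elim x)
    show ?case
    proof
      fix i
      assume "i \<in> I"
      then obtain j where j: "e j = i"
        using e_surj by blast
      have le: "t j n x \<le> h n x" for n
        using sum_le_suminf[OF t_summable[OF elim(2)], of "{j}" n] t_bound[OF elim(2)]
        by (simp add: h_def)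
      have "(\<lambda>n. t j (r n) x) \<longlonglongrightarrow> 0"
        by (rule tendsto_sandwich[OF _ _ tendsto_const elim(1)]) (use le t_bound[OF elim(2)] in auto)
      from tendsto_mult_right_zero[OF this, of "2 ^ j"]
      show "(\<lambda>n. f i (r n) x) \<longlonglongrightarrow> 0"
        by (simp add: t_def j power_divide)
    qed
  qed
  with r(1) show ?thesis
    by blast
qed

section \<open>Fibre measures of a factor map\<close>

lemma dirac_measure_eq_indicator:
  assumes "prob_space N" and "measure N {p} = 1" and "A \<in> sets N" and "{p} \<in> sets N"
  shows "measure N A = indicator A p"
proof -
  interpret prob_space N by fact
  show ?thesis
  proof (cases "p \<in> A")
    case True
    then have "measure N {p} \<le> measure N A"
      by (intro finite_measure_mono) (use assms in auto)
    then show ?thesis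
      using True assms(2) prob_le_1[of A] by simp
  next
    case False
    then have "measure N (A \<union> {p}) = measure N A + measure N {p}"
      using assms by (intro finite_measure_Union) auto
    then show ?thesis
      using False assms(2) prob_le_1[of "A \<union> {p}"] measure_nonneg[of N A] by simp
  qed
qed

text \<open>The factor map with its fibre measures \<open>D\<close> and a fixed countable base \<open>\<B>\<close> of the
  compact space. Statements about almost every fibre are made for sets of \<open>\<B>\<close>, so that
  only countably many null sets have to be discarded.\<close>

locale fibred_system = group G
  for G :: "('g, 'c) monoid_scheme" (structure) +
  fixes \<alpha> :: "'g \<Rightarrow> 'x::metric_space \<Rightarrow> 'x" and \<mu> :: "'x measure"
    and \<beta> :: "'g \<Rightarrow> 'y \<Rightarrow> 'y" and \<nu> :: "'y measure"
    and \<pi> :: "'x \<Rightarrow> 'y" and D :: "'y \<Rightarrow> 'x measure" and \<B> :: "'x set set"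
  assumes countable_G: "countable (carrier G)"
    and compact_space: "compact (UNIV :: 'x set)"
    and \<alpha>_continuous: "g \<in> carrier G \<Longrightarrow> continuous_on UNIV (\<alpha> g)"
    and sets_\<mu>: "sets \<mu> = sets borel"
    and system_\<mu>: "pmp_system G \<mu> \<alpha>" and system_\<nu>: "pmp_system G \<nu> \<beta>"
    and factor: "factor_map G \<mu> \<alpha> \<nu> \<beta> \<pi>"
    and disintegration: "disintegration \<mu> \<nu> \<pi> D"
    and countable_base: "countable \<B>"
    and base_open: "V \<in> \<B> \<Longrightarrow> open V"
    and base_nbhd: "open U \<Longrightarrow> x \<in> U \<Longrightarrow> \<exists>V\<in>\<B>. x \<in> V \<and> V \<subseteq> U"
begin

sublocale \<mu>: prob_space \<mu>
  using system_\<mu> by (simp add: pmp_system_def)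

sublocale \<nu>: prob_space \<nu>
  using system_\<nu> by (simp add: pmp_system_def)

lemma space_\<mu>: "space \<mu> = UNIV"
  using sets_eq_imp_space_eq[OF sets_\<mu>] by simp

sublocale \<alpha>: group_action G UNIV \<alpha>
  using system_\<mu> space_\<mu> by (simp add: pmp_system_def)

sublocale \<beta>: group_action G "space \<nu>" \<beta>
  using system_\<nu> by (simp add: pmp_system_def)

lemma \<alpha>_measurable: "g \<in> carrier G \<Longrightarrow> \<alpha> g \<in> measurable \<mu> \<mu>"
  and \<alpha>_preserves: "g \<in> carrier G \<Longrightarrow> distr \<mu> \<mu> (\<alpha> g) = \<mu>"
  and \<beta>_measurable: "g \<in> carrier G \<Longrightarrow> \<beta> g \<in> measurable \<nu> \<nu>"
  and \<beta>_preserves: "g \<in> carrier G \<Longrightarrow> distr \<nu> \<nu> (\<beta> g) = \<nu>"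
  using system_\<mu> system_\<nu> by (auto simp: pmp_system_def)

lemma \<pi>_measurable: "\<pi> \<in> measurable \<mu> \<nu>"
  and \<pi>_preserves: "distr \<mu> \<nu> \<pi> = \<nu>"
  and \<pi>_equivariant: "g \<in> carrier G \<Longrightarrow> AE x in \<mu>. \<pi> (\<alpha> g x) = \<beta> g (\<pi> x)"
  using factor by (auto simp: factor_map_def)

lemma \<pi>_space: "\<pi> x \<in> space \<nu>"
  using measurable_space[OF \<pi>_measurable, of x] space_\<mu> by simp

lemma \<alpha>_vimage: "g \<in> carrier G \<Longrightarrow> A \<in> sets borel \<Longrightarrow> \<alpha> g -` A \<in> sets borel"
  using measurable_sets[OF \<alpha>_measurable, of g A] space_\<mu> sets_\<mu> by simp

lemma \<pi>_vimage: "B \<in> sets \<nu> \<Longrightarrow> \<pi> -` B \<in> sets borel"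
  using measurable_sets[OF \<pi>_measurable, of B] space_\<mu> sets_\<mu> by simp

lemma D_measurable: "D \<in> measurable \<nu> (subprob_algebra \<mu>)"
  using disintegration by (simp add: disintegration_def measurable_prob_algebraD)

lemma prob_space_D: "y \<in> space \<nu> \<Longrightarrow> prob_space (D y)"
  and sets_D: "y \<in> space \<nu> \<Longrightarrow> sets (D y) = sets borel"
  using disintegration measurable_space[of D \<nu> "prob_algebra \<mu>" y] sets_\<mu>
  by (auto simp: disintegration_def space_prob_algebra)

lemma space_D: "y \<in> space \<nu> \<Longrightarrow> space (D y) = UNIV"
  using sets_eq_imp_space_eq[OF sets_D] by simp

lemma emeasure_D_measurable: "A \<in> sets borel \<Longrightarrow> (\<lambda>y. emeasure (D y) A) \<in> borel_measurable \<nu>"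
  and measure_D_measurable: "A \<in> sets borel \<Longrightarrow> (\<lambda>y. measure (D y) A) \<in> borel_measurable \<nu>"
  using measurable_compose[OF D_measurable measurable_emeasure_subprob_algebra, of A]
    measurable_compose[OF D_measurable measurable_measure_subprob_algebra, of A] sets_\<mu> by auto

lemma measure_D_bounds: "y \<in> space \<nu> \<Longrightarrow> 0 \<le> measure (D y) A \<and> measure (D y) A \<le> 1"
  using prob_space.prob_le_1[OF prob_space_D] by auto

lemma disintegrate: "A \<in> sets borel \<Longrightarrow> emeasure \<mu> A = (\<integral>\<^sup>+ y. emeasure (D y) A \<partial>\<nu>)"
  using disintegration sets_\<mu> by (simp add: disintegration_def)

lemma fibre_full: "AE y in \<nu>. emeasure (D y) (\<pi> -` {y}) = 1"
  using disintegration space_\<mu> by (simp add: disintegration_def)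

lemma D_on_fibre: "AE y in \<nu>. AE x in D y. \<pi> x = y"
  using fibre_full AE_space
proof eventually_elim
  case (elim y)
  interpret prob_space "D y"
    using prob_space_D elim(2) .
  have "AE x in D y. x \<in> \<pi> -` {y}"
    using elim(1) by (intro AE_prob_1) (simp add: measure_def)
  then show ?case
    by simp
qed

lemma AE_D:
  assumes "AE x in \<mu>. P x"
  shows "AE y in \<nu>. AE x in D y. P x"
proof -
  obtain N where N: "{x \<in> space \<mu>. \<not> P x} \<subseteq> N" "emeasure \<mu> N = 0" "N \<in> sets \<mu>"
    using AE_E[OF assms] .
  have N_borel: "N \<in> sets borel"
    using N(3) sets_\<mu> by simp
  have "AE y in \<nu>. emeasure (D y) N = 0"
    using N(2) disintegrate[OF N_borel] emeasure_D_measurable[OF N_borel]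
    by (simp add: nn_integral_0_iff_AE)
  then show ?thesis
    using AE_space
  proof eventually_elim
    case (elim y)
    show ?case
    proof (rule AE_I)
      show "{x \<in> space (D y). \<not> P x} \<subseteq> N"
        using N(1) space_\<mu> by auto
    qed (use elim N_borel sets_D in auto)
  qed
qed

lemma disintegrate_over_base:
  assumes A: "A \<in> sets borel" and B: "B \<in> sets \<nu>"
  shows "emeasure \<mu> (A \<inter> \<pi> -` B) = (\<integral>\<^sup>+ y\<in>B. emeasure (D y) A \<partial>\<nu>)"
proof -
  have meas: "A \<inter> \<pi> -` B \<in> sets borel"
    using A \<pi>_vimage[OF B] by simp
  have "AE y in \<nu>. emeasure (D y) (A \<inter> \<pi> -` B) = emeasure (D y) A * indicator B y"
    using D_on_fibre AE_space
  proof eventually_elim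
    case (elim y)
    have "emeasure (D y) (A \<inter> \<pi> -` B) = emeasure (D y) (if y \<in> B then A else {})"
      using elim(1) by (intro emeasure_eq_AE) (use meas A sets_D[OF elim(2)] in \<open>auto elim!: eventually_mono\<close>)
    then show ?case
      by (auto split: split_indicator)
  qed
  then show ?thesis
    unfolding disintegrate[OF meas] by (rule nn_integral_cong_AE)
qed

text \<open>Both sides have the same integral over every \<open>B\<close>: by invariance of \<open>\<nu>\<close> and \<open>\<mu>\<close>, each is the
  \<open>\<mu>\<close>-measure of \<open>\<alpha> g -` A\<close> intersected with the fibres over \<open>B\<close>.\<close>

lemma fibre_measures_equivariant:
  assumes g: "g \<in> carrier G" and A: "A \<in> sets borel"
  shows "AE y in \<nu>. measure (D (\<beta> g y)) A = measure (D y) (\<alpha> g -` A)"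
proof -
  have "AE y in \<nu>. emeasure (D (\<beta> g y)) A = emeasure (D y) (\<alpha> g -` A)"
  proof (rule \<nu>.density_unique2)
    show "(\<lambda>y. emeasure (D (\<beta> g y)) A) \<in> borel_measurable \<nu>"
      using measurable_compose[OF \<beta>_measurable[OF g] emeasure_D_measurable[OF A]] .
    show "(\<lambda>y. emeasure (D y) (\<alpha> g -` A)) \<in> borel_measurable \<nu>"
      using emeasure_D_measurable[OF \<alpha>_vimage[OF g A]] .
  next
    fix B
    assume B: "B \<in> sets \<nu>"
    \<comment> \<open>This is the image of \<open>B\<close> under \<open>\<beta> g\<close>, written as a preimage to make it measurable.\<close>
    define B' where "B' = \<beta> (inv g) -` B \<inter> space \<nu>"
    have B': "B' \<in> sets \<nu>"
      unfolding B'_def using \<beta>_measurable[of "inv g"] g B by (intro measurable_sets) auto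
    have B'_iff: "\<beta> g y \<in> B' \<longleftrightarrow> y \<in> B" if "y \<in> space \<nu>" for y
      using \<beta>.orbit_sym_aux[OF g that refl] measurable_space[OF \<beta>_measurable[OF g] that]
      by (simp add: B'_def)
    have "(\<integral>\<^sup>+ y\<in>B. emeasure (D (\<beta> g y)) A \<partial>\<nu>)
        = (\<integral>\<^sup>+ y. emeasure (D (\<beta> g y)) A * indicator B' (\<beta> g y) \<partial>\<nu>)"
      by (rule nn_integral_cong) (auto simp: B'_iff split: split_indicator)
    also have "\<dots> = (\<integral>\<^sup>+ y\<in>B'. emeasure (D y) A \<partial>distr \<nu> \<nu> (\<beta> g))"
      using \<beta>_measurable[OF g] emeasure_D_measurable[OF A] B' by (subst nn_integral_distr) auto
    also have "\<dots> = emeasure \<mu> (A \<inter> \<pi> -` B')"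
      unfolding \<beta>_preserves[OF g] by (rule disintegrate_over_base[OF A B', symmetric])
    also have "\<dots> = emeasure (distr \<mu> \<mu> (\<alpha> g)) (A \<inter> \<pi> -` B')"
      by (simp only: \<alpha>_preserves[OF g])
    also have "\<dots> = emeasure \<mu> (\<alpha> g -` (A \<inter> \<pi> -` B'))"
      using \<alpha>_measurable[OF g] A \<pi>_vimage[OF B'] sets_\<mu> space_\<mu> by (subst emeasure_distr) auto
    also have "\<dots> = emeasure \<mu> (\<alpha> g -` A \<inter> \<pi> -` B)"
    proof (rule emeasure_eq_AE)
      show "AE x in \<mu>. x \<in> \<alpha> g -` (A \<inter> \<pi> -` B') \<longleftrightarrow> x \<in> \<alpha> g -` A \<inter> \<pi> -` B"
        using \<pi>_equivariant[OF g] by eventually_elim (use B'_iff \<pi>_space in auto)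
      show "\<alpha> g -` (A \<inter> \<pi> -` B') \<in> sets \<mu>"
        using \<alpha>_vimage[OF g] A \<pi>_vimage[OF B'] sets_\<mu> by blast
      show "\<alpha> g -` A \<inter> \<pi> -` B \<in> sets \<mu>"
        using \<alpha>_vimage[OF g A] \<pi>_vimage[OF B] sets_\<mu> by blast
    qed
    also have "\<dots> = (\<integral>\<^sup>+ y\<in>B. emeasure (D y) (\<alpha> g -` A) \<partial>\<nu>)"
      by (rule disintegrate_over_base[OF \<alpha>_vimage[OF g A] B])
    finally show "(\<integral>\<^sup>+ y\<in>B. emeasure (D (\<beta> g y)) A \<partial>\<nu>)
        = (\<integral>\<^sup>+ y\<in>B. emeasure (D y) (\<alpha> g -` A) \<partial>\<nu>)" .
  qed
  then show ?thesis
    by (rule eventually_mono) (simp add: measure_def)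
qed

section \<open>Correlations in the fibres\<close>

definition centred :: "'x set \<Rightarrow> 'x \<Rightarrow> real" where
  "centred A x = indicator A x - measure (D (\<pi> x)) A"

definition fibre_correlation :: "'g \<Rightarrow> 'x set \<Rightarrow> 'x set \<Rightarrow> 'y \<Rightarrow> real" where
  "fibre_correlation g U V y =
     measure (D y) (U \<inter> \<alpha> g -` V) - measure (D y) U * measure (D y) (\<alpha> g -` V)"

lemma fibre_correlation_measurable:
  assumes "g \<in> carrier G" "U \<in> sets borel" "V \<in> sets borel"
  shows "fibre_correlation g U V \<in> borel_measurable \<nu>"
  unfolding fibre_correlation_def using \<alpha>_vimage[OF assms(1,3)] assms(2)
  by (intro borel_measurable_diff borel_measurable_times measure_D_measurable) auto

lemma fibre_correlation_bound:
  assumes y: "y \<in> space \<nu>"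
  shows "\<bar>fibre_correlation g U V y\<bar> \<le> 1"
proof -
  have "0 \<le> measure (D y) U * measure (D y) (\<alpha> g -` V)"
    "measure (D y) U * measure (D y) (\<alpha> g -` V) \<le> 1"
    using measure_D_bounds[OF y] by (auto intro: mult_le_one)
  then show ?thesis
    using measure_D_bounds[OF y, of "U \<inter> \<alpha> g -` V"] unfolding fibre_correlation_def by linarith
qed

lemma centred_measurable:
  assumes "A \<in> sets borel"
  shows "centred A \<in> borel_measurable \<mu>"
proof -
  have "(\<lambda>x. measure (D (\<pi> x)) A) \<in> borel_measurable \<mu>"
    using measurable_compose[OF \<pi>_measurable measure_D_measurable[OF assms]] .
  then show ?thesis
    unfolding centred_def using assms sets_\<mu> by measurable
qed

lemma centred_in_L_infinity:
  assumes "A \<in> sets borel"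
  shows "centred A \<in> L_infinity \<mu>"
proof -
  have "\<bar>centred A x\<bar> \<le> 1" for x
  proof -
    have "indicator A x = (0 :: real) \<or> indicator A x = (1 :: real)"
      by (simp add: indicator_def)
    then show ?thesis
      using measure_D_bounds[OF \<pi>_space[of x], of A] unfolding centred_def by linarith
  qed
  then show ?thesis
    unfolding L_infinity_def using centred_measurable[OF assms] by blast
qed

lemma fibre_expectation_centred:
  assumes A: "A \<in> sets borel"
  shows "AE y in \<nu>. fibre_expectation D (centred A) y = 0"
  using D_on_fibre AE_space
proof eventually_elim
  case (elim y)
  interpret prob_space "D y"
    using prob_space_D elim(2) .
  have AD: "A \<in> sets (D y)"
    using A sets_D elim(2) by simp
  have cong: "centred A \<in> borel_measurable (D y)"
    using centred_measurable[OF A] sets_\<mu> sets_D[OF elim(2)] measurable_cong_sets by blast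
  have "fibre_expectation D (centred A) y = (\<integral>x. indicator A x - measure (D y) A \<partial>D y)"
    unfolding fibre_expectation_def
    by (rule integral_cong_AE) (use cong AD elim(1) in \<open>auto simp: centred_def elim!: eventually_mono\<close>)
  also have "\<dots> = 0"
    using AD by (simp add: prob_space integrable_real_indicator emeasure_eq_measure)
  finally show ?case .
qed

text \<open>On the fibre over \<open>y\<close> the two subtracted means are constants \<open>a\<close> and \<open>u\<close>. Since the second factor has mean
  zero there, the constant \<open>a\<close> contributes nothing, and what is left is the covariance of \<open>U\<close> and \<open>\<alpha> g -` V\<close>.\<close>

lemma fibre_expectation_translate_centred:
  assumes g: "g \<in> carrier G" and U: "U \<in> sets borel" and V: "V \<in> sets borel"
  shows "AE y in \<nu>. fibre_expectation D (\<lambda>x. translate G \<alpha> (inv g) (centred V) x * centred U x) y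
    = fibre_correlation g U V y"
  using D_on_fibre AE_D[OF \<pi>_equivariant[OF g]] AE_space
proof eventually_elim
  case (elim y)
  interpret prob_space "D y"
    using prob_space_D elim(3) .
  note sets = sets_D[OF elim(3)]
  define a where "a = measure (D (\<beta> g y)) V"
  define u where "u = measure (D y) U"
  let ?V = "\<alpha> g -` V"
  have meas: "U \<in> sets (D y)" "?V \<in> sets (D y)" "U \<inter> ?V \<in> sets (D y)"
    using U \<alpha>_vimage[OF g V] sets by auto
  have "(\<lambda>x. centred V (\<alpha> g x)) \<in> borel_measurable \<mu>"
    using measurable_compose[OF \<alpha>_measurable[OF g] centred_measurable[OF V]] .
  then have "(\<lambda>x. centred V (\<alpha> g x) * centred U x) \<in> borel_measurable \<mu>"
    using centred_measurable[OF U] by (rule borel_measurable_times)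
  then have m: "(\<lambda>x. centred V (\<alpha> g x) * centred U x) \<in> borel_measurable (D y)"
    using sets_\<mu> sets measurable_cong_sets by blast
  have "fibre_expectation D (\<lambda>x. translate G \<alpha> (inv g) (centred V) x * centred U x) y
      = (\<integral>x. centred V (\<alpha> g x) * centred U x \<partial>D y)"
    using g by (simp add: fibre_expectation_def translate_def)
  also have "\<dots> = (\<integral>x. indicator (U \<inter> ?V) x - u * indicator ?V x - a * indicator U x + a * u \<partial>D y)"
  proof (rule integral_cong_AE[OF m])
    show "AE x in D y. centred V (\<alpha> g x) * centred U x
        = indicator (U \<inter> ?V) x - u * indicator ?V x - a * indicator U x + a * u"
      using elim(1,2) by eventually_elim
        (auto simp: centred_def a_def u_def algebra_simps split: split_indicator)
  qed (use meas in measurable)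
  also have "\<dots> = measure (D y) (U \<inter> ?V) - u * measure (D y) ?V - a * measure (D y) U + a * u"
    using meas by (simp add: prob_space integrable_real_indicator emeasure_eq_measure)
  also have "\<dots> = fibre_correlation g U V y"
    by (simp add: fibre_correlation_def u_def)
  finally show ?case .
qed

section \<open>Fibres that are points\<close>

text \<open>If \<open>D y\<close> is concentrated at a point \<open>\<phi> y\<close>, then \<open>\<phi>\<close> is a measurable inverse of \<open>\<pi>\<close> up to null sets. The null sets
  are then removed invariantly: the points whose whole orbit avoids them form an invariant set, which is conull because
  the group is countable.\<close>

lemma dirac_fibres_imp_isomorphism:
  assumes dirac: "AE y in \<nu>. \<exists>x. measure (D y) {x} = 1"
  shows "factor_isomorphism G \<mu> \<alpha> \<nu> \<beta> \<pi>"
proof -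
  have "AE y in \<nu>. (\<exists>x. measure (D y) {x} = 1) \<and> emeasure (D y) (\<pi> -` {y}) = 1"
    using dirac fibre_full by eventually_elim simp
  then obtain N where N: "{y \<in> space \<nu>. \<not> ((\<exists>x. measure (D y) {x} = 1) \<and> emeasure (D y) (\<pi> -` {y}) = 1)} \<subseteq> N"
      "emeasure \<nu> N = 0" "N \<in> sets \<nu>"
    by (rule AE_E)
  define Y where "Y = space \<nu> - N"
  have Y_sets: "Y \<in> sets \<nu>"
    using N(3) by (auto simp: Y_def)
  have Y_space: "y \<in> space \<nu>" if "y \<in> Y" for y
    using that by (simp add: Y_def)
  have AE_Y: "AE y in \<nu>. y \<in> Y"
    using N(2,3) by (intro AE_I[of _ _ N]) (auto simp: Y_def)
  define \<phi> where "\<phi> y = (if y \<in> Y then SOME x. measure (D y) {x} = 1 else undefined)" for y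
  have D_eq: "measure (D y) A = indicator A (\<phi> y)" if "y \<in> Y" "A \<in> sets borel" for y A
  proof (rule dirac_measure_eq_indicator)
    show "prob_space (D y)"
      using prob_space_D Y_space that(1) .
    have "\<exists>x. measure (D y) {x} = 1"
      using N(1) that(1) by (auto simp: Y_def)
    then have "measure (D y) {SOME x. measure (D y) {x} = 1} = 1"
      by (rule someI_ex)
    then show "measure (D y) {\<phi> y} = 1"
      using that(1) by (simp add: \<phi>_def)
  qed (use sets_D[OF Y_space[OF that(1)]] that(2) in auto)
  have \<pi>\<phi>: "\<pi> (\<phi> y) = y" if "y \<in> Y" for y
  proof -
    have full: "emeasure (D y) (\<pi> -` {y}) = 1"
      using N(1) that by (auto simp: Y_def)
    then have "\<pi> -` {y} \<in> sets (D y)"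
      using emeasure_neq_0_sets[of "D y" "\<pi> -` {y}"] by simp
    then have "\<pi> -` {y} \<in> sets borel"
      using sets_D[OF Y_space[OF that]] by simp
    from D_eq[OF that this] full show ?thesis
      by (auto simp: measure_def indicator_def split: if_splits)
  qed
  have \<phi>_meas: "\<phi> \<in> borel_measurable \<nu>"
  proof (rule borel_measurableI)
    fix S :: "'x set"
    assume S: "open S"
    have "\<phi> -` S \<inter> space \<nu> = {y \<in> space \<nu>. measure (D y) S = 1} \<inter> Y
        \<union> (if undefined \<in> S then space \<nu> - Y else {})"
      using D_eq[of _ S] S Y_space by (auto simp: \<phi>_def[of "_"] indicator_def split: if_splits)
    moreover have "{y \<in> space \<nu>. measure (D y) S = 1} \<in> sets \<nu>"
      using measure_D_measurable[of S] S by measurable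
    ultimately show "\<phi> -` S \<inter> space \<nu> \<in> sets \<nu>"
      using Y_sets by auto
  qed
  define E where "E = {x. \<phi> (\<pi> x) = x}"
  have "- E = (\<Union>V\<in>\<B>. V \<inter> (\<lambda>x. \<phi> (\<pi> x)) -` (- V))"
  proof (intro equalityI subsetI)
    fix x
    assume "x \<in> - E"
    then have "open (- {\<phi> (\<pi> x)})" "x \<in> - {\<phi> (\<pi> x)}"
      by (auto simp: E_def)
    then obtain V where "V \<in> \<B>" "x \<in> V" "V \<subseteq> - {\<phi> (\<pi> x)}"
      using base_nbhd by meson
    then show "x \<in> (\<Union>V\<in>\<B>. V \<inter> (\<lambda>x. \<phi> (\<pi> x)) -` (- V))"
      by (intro UN_I[of V]) auto
  qed (auto simp: E_def)
  moreover have "(\<Union>V\<in>\<B>. V \<inter> (\<lambda>x. \<phi> (\<pi> x)) -` (- V)) \<in> sets borel"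
  proof (rule sets.countable_UN''[OF countable_base])
    fix V
    assume V: "V \<in> \<B>"
    have "(\<lambda>x. \<phi> (\<pi> x)) \<in> borel_measurable \<mu>"
      using measurable_compose[OF \<pi>_measurable \<phi>_meas] .
    then have "(\<lambda>x. \<phi> (\<pi> x)) -` (- V) \<in> sets borel"
      using measurable_sets[of _ \<mu> borel "- V"] base_open[OF V] space_\<mu> sets_\<mu> by auto
    then show "V \<inter> (\<lambda>x. \<phi> (\<pi> x)) -` (- V) \<in> sets borel"
      using base_open[OF V] by auto
  qed
  ultimately have "- E \<in> sets borel"
    by simp
  then have E_sets: "E \<in> sets borel"
    using sets.compl_sets[of "- E" borel] by (simp add: Compl_eq_Diff_UNIV double_diff)
  have AE_\<pi>_Y: "AE x in \<mu>. \<pi> x \<in> Y"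
    by (rule AE_distrD[OF \<pi>_measurable]) (simp only: \<pi>_preserves AE_Y)
  have "AE x in \<mu>. x \<in> E"
  proof (rule AE_I)
    have "AE y in \<nu>. emeasure (D y) (- E) = 0"
      using AE_Y
    proof eventually_elim
      case (elim y)
      interpret prob_space "D y"
        using prob_space_D Y_space elim .
      show ?case
        using D_eq[OF elim \<open>- E \<in> sets borel\<close>] \<pi>\<phi>[OF elim] by (simp add: emeasure_eq_measure E_def)
    qed
    then show "emeasure \<mu> (- E) = 0"
      using disintegrate[OF \<open>- E \<in> sets borel\<close>] emeasure_D_measurable[OF \<open>- E \<in> sets borel\<close>]
      by (simp add: nn_integral_0_iff_AE)
  qed (use \<open>- E \<in> sets borel\<close> sets_\<mu> in auto)
  have "\<exists>Z. Z \<in> sets borel \<and> (AE x in \<mu>. x \<in> Z) \<and> (\<forall>x\<in>Z. \<pi> (\<alpha> g x) = \<beta> g (\<pi> x))"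
    if g: "g \<in> carrier G" for g
  proof -
    obtain N where N: "{x \<in> space \<mu>. \<not> \<pi> (\<alpha> g x) = \<beta> g (\<pi> x)} \<subseteq> N" "emeasure \<mu> N = 0" "N \<in> sets \<mu>"
      using AE_E[OF \<pi>_equivariant[OF g]] .
    have "- N \<in> sets borel"
      using N(3) sets_\<mu> by (simp add: Compl_eq_Diff_UNIV sets.compl_sets[of N borel, simplified])
    moreover have "AE x in \<mu>. x \<in> - N"
      using N(2,3) by (intro AE_I[of _ _ N]) auto
    ultimately show ?thesis
      using N(1) space_\<mu> by (intro exI[of _ "- N"]) auto
  qed
  then obtain Z where Z: "\<And>g. g \<in> carrier G \<Longrightarrow> Z g \<in> sets borel"
      "\<And>g. g \<in> carrier G \<Longrightarrow> AE x in \<mu>. x \<in> Z g"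
      "\<And>g x. g \<in> carrier G \<Longrightarrow> x \<in> Z g \<Longrightarrow> \<pi> (\<alpha> g x) = \<beta> g (\<pi> x)"
    by metis
  have ne: "carrier G \<noteq> {}"
    using one_closed by blast
  \<comment> \<open>The conull set on which \<open>\<phi>\<close> inverts \<open>\<pi>\<close> and \<open>\<pi>\<close> is equivariant.\<close>
  define W where "W = E \<inter> \<pi> -` Y \<inter> (\<Inter>g\<in>carrier G. Z g)"
  have "(\<Inter>g\<in>carrier G. Z g) \<in> sets borel"
    using Z(1) ne by (intro sets.countable_INT'' countable_G) auto
  then have W_sets: "W \<in> sets borel"
    unfolding W_def using E_sets \<pi>_vimage[OF Y_sets] by auto
  have "AE x in \<mu>. \<forall>g\<in>carrier G. x \<in> Z g"
    using Z(2) countable_G by (simp add: AE_ball_countable)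
  then have AE_W: "AE x in \<mu>. x \<in> W"
    using \<open>AE x in \<mu>. x \<in> E\<close> AE_\<pi>_Y by eventually_elim (simp add: W_def)
  define X\<^sub>0 where "X\<^sub>0 = {x. \<forall>g\<in>carrier G. \<alpha> g x \<in> W}"
  define Y\<^sub>0 where "Y\<^sub>0 = {y \<in> Y. \<phi> y \<in> X\<^sub>0}"
  have X\<^sub>0_W: "x \<in> W" if "x \<in> X\<^sub>0" for x
  proof -
    have "\<alpha> \<one> x \<in> W"
      using that by (simp add: X\<^sub>0_def)
    then show ?thesis
      by (simp flip: \<alpha>.id_eq_one)
  qed
  have X\<^sub>0_sets: "X\<^sub>0 \<in> sets borel"
  proof -
    have "X\<^sub>0 = (\<Inter>g\<in>carrier G. \<alpha> g -` W)"
      by (auto simp: X\<^sub>0_def)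
    also have "\<dots> \<in> sets borel"
      using \<alpha>_vimage[OF _ W_sets] ne by (intro sets.countable_INT'' countable_G) auto
    finally show ?thesis .
  qed
  have "AE x in \<mu>. \<alpha> g x \<in> W" if "g \<in> carrier G" for g
    by (rule AE_distrD[OF \<alpha>_measurable[OF that]]) (simp only: \<alpha>_preserves[OF that] AE_W)
  then have AE_X\<^sub>0: "AE x in \<mu>. x \<in> X\<^sub>0"
    using countable_G by (simp add: X\<^sub>0_def AE_ball_countable)
  have \<alpha>_X\<^sub>0: "\<alpha> g x \<in> X\<^sub>0" if g: "g \<in> carrier G" and x: "x \<in> X\<^sub>0" for g x
    unfolding X\<^sub>0_def mem_Collect_eq
  proof
    fix h
    assume h: "h \<in> carrier G"
    then have "\<alpha> (h \<otimes> g) x \<in> W"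
      using x g unfolding X\<^sub>0_def by blast
    then show "\<alpha> h (\<alpha> g x) \<in> W"
      using \<alpha>.composition_rule[OF UNIV_I h g] by simp
  qed
  have X\<^sub>0_inv: "\<alpha> g ` X\<^sub>0 = X\<^sub>0" if g: "g \<in> carrier G" for g
  proof (intro equalityI subsetI)
    fix x
    assume x: "x \<in> X\<^sub>0"
    have "\<alpha> g (\<alpha> (inv g) x) = x"
      using \<alpha>.orbit_sym_aux[of "inv g" x] g by simp
    moreover have "\<alpha> (inv g) x \<in> X\<^sub>0"
      using \<alpha>_X\<^sub>0 g x by simp
    ultimately show "x \<in> \<alpha> g ` X\<^sub>0"
      by (metis imageI)
  qed (use \<alpha>_X\<^sub>0[OF g] in auto)
  have \<phi>\<pi>: "\<phi> (\<pi> x) = x" and \<pi>_Y: "\<pi> x \<in> Y" if "x \<in> X\<^sub>0" for x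
    using X\<^sub>0_W[OF that] by (auto simp: W_def E_def)
  have \<pi>_X\<^sub>0: "\<pi> ` X\<^sub>0 = Y\<^sub>0"
  proof (intro equalityI subsetI)
    fix y
    assume "y \<in> Y\<^sub>0"
    then show "y \<in> \<pi> ` X\<^sub>0"
      using \<pi>\<phi>[of y] by (metis (mono_tags, lifting) Y\<^sub>0_def imageI mem_Collect_eq)
  qed (auto simp: Y\<^sub>0_def \<phi>\<pi> \<pi>_Y)
  have equi: "\<pi> (\<alpha> g x) = \<beta> g (\<pi> x)" if "g \<in> carrier G" "x \<in> X\<^sub>0" for g x
    using Z(3)[OF that(1)] X\<^sub>0_W[OF that(2)] that(1) by (auto simp: W_def)
  have Y\<^sub>0_sets: "Y\<^sub>0 \<in> sets \<nu>"
  proof -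
    have "Y\<^sub>0 = (\<phi> -` X\<^sub>0 \<inter> space \<nu>) \<inter> Y"
      using Y_space by (auto simp: Y\<^sub>0_def)
    then show ?thesis
      using measurable_sets[OF \<phi>_meas X\<^sub>0_sets] Y_sets by simp
  qed
  have AE_Y\<^sub>0: "AE y in \<nu>. y \<in> Y\<^sub>0"
    using AE_Y AE_D[OF AE_X\<^sub>0]
  proof eventually_elim
    case (elim y)
    interpret prob_space "D y"
      using prob_space_D Y_space elim(1) .
    have "X\<^sub>0 \<in> sets (D y)"
      using X\<^sub>0_sets sets_D[OF Y_space[OF elim(1)]] by simp
    then have "measure (D y) X\<^sub>0 = 1"
      using elim(2) by (simp add: prob_eq_1)
    then show ?case
      using D_eq[OF elim(1) X\<^sub>0_sets] elim(1) by (auto simp: Y\<^sub>0_def indicator_def split: if_splits)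
  qed
  have Y\<^sub>0_inv: "\<beta> g ` Y\<^sub>0 = Y\<^sub>0" if "g \<in> carrier G" for g
  proof -
    have "\<beta> g ` Y\<^sub>0 = (\<lambda>x. \<beta> g (\<pi> x)) ` X\<^sub>0"
      by (simp flip: \<pi>_X\<^sub>0 add: image_image)
    also have "\<dots> = (\<lambda>x. \<pi> (\<alpha> g x)) ` X\<^sub>0"
      using equi[OF that] by (intro image_cong) auto
    also have "\<dots> = \<pi> ` \<alpha> g ` X\<^sub>0"
      by (simp add: image_image)
    finally show ?thesis
      using X\<^sub>0_inv[OF that] \<pi>_X\<^sub>0 by simp
  qed
  have inj: "inj_on \<pi> X\<^sub>0"
    using \<phi>\<pi> by (rule inj_on_inverseI)
  have "the_inv_into X\<^sub>0 \<pi> \<in> measurable (restrict_space \<nu> Y\<^sub>0) (restrict_space \<mu> X\<^sub>0)"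
  proof (subst measurable_cong)
    fix y
    assume "y \<in> space (restrict_space \<nu> Y\<^sub>0)"
    then have "y \<in> Y\<^sub>0"
      by (simp add: space_restrict_space)
    then show "the_inv_into X\<^sub>0 \<pi> y = \<phi> y"
      using \<pi>\<phi>[of y] by (intro the_inv_into_f_eq inj) (auto simp: Y\<^sub>0_def)
  next
    have "\<phi> \<in> measurable \<nu> \<mu>"
      using \<phi>_meas measurable_cong_sets[OF refl sets_\<mu>] by blast
    then show "\<phi> \<in> measurable (restrict_space \<nu> Y\<^sub>0) (restrict_space \<mu> X\<^sub>0)"
      by (rule measurable_restrict_space3) (auto simp: Y\<^sub>0_def)
  qed
  moreover have "\<pi> \<in> measurable (restrict_space \<mu> X\<^sub>0) (restrict_space \<nu> Y\<^sub>0)"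
    using \<pi>_measurable by (rule measurable_restrict_space3) (use \<pi>_X\<^sub>0 in auto)
  moreover have "bij_betw \<pi> X\<^sub>0 Y\<^sub>0"
    using inj \<pi>_X\<^sub>0 by (simp add: bij_betw_def)
  moreover have "invariant_conull G \<mu> \<alpha> X\<^sub>0"
    using X\<^sub>0_sets sets_\<mu> AE_X\<^sub>0 X\<^sub>0_inv by (simp add: invariant_conull_def)
  moreover have "invariant_conull G \<nu> \<beta> Y\<^sub>0"
    using Y\<^sub>0_sets AE_Y\<^sub>0 Y\<^sub>0_inv by (simp add: invariant_conull_def)
  ultimately show ?thesis
    unfolding factor_isomorphism_def using equi by blast
qed

section \<open>Recurrence\<close>

text \<open>Otherwise the indicators of the preimages of \<open>B\<close> would tend to \<open>0\<close> almost everywhere, hence in the mean,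
  although invariance gives each of them the integral \<open>measure \<nu> B\<close>.\<close>

lemma recurrence:
  assumes g: "\<And>k. g k \<in> carrier G" and B: "B \<in> sets \<nu>" "measure \<nu> B > 0"
  shows "\<not> (AE y in \<nu>. \<not> (\<exists>\<^sub>F k in sequentially. \<beta> (g k) y \<in> B))"
proof
  assume AE: "AE y in \<nu>. \<not> (\<exists>\<^sub>F k in sequentially. \<beta> (g k) y \<in> B)"
  have "(\<lambda>k. \<integral>y. indicator B (\<beta> (g k) y) \<partial>\<nu>) \<longlonglongrightarrow> (\<integral>y. (0 :: real) \<partial>\<nu>)"
  proof (rule integral_dominated_convergence[where w = "\<lambda>_. 1"])
    show "(\<lambda>y. indicator B (\<beta> (g k) y) :: real) \<in> borel_measurable \<nu>" for k
      using measurable_compose[OF \<beta>_measurable[OF g] borel_measurable_indicator[OF B(1)]] .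
    show "AE y in \<nu>. (\<lambda>k. indicator B (\<beta> (g k) y) :: real) \<longlonglongrightarrow> 0"
      using AE
    proof eventually_elim
      case (elim y)
      then have "\<forall>\<^sub>F k in sequentially. \<beta> (g k) y \<notin> B"
        by (simp add: not_frequently)
      then have "\<forall>\<^sub>F k in sequentially. (indicator B (\<beta> (g k) y) :: real) = 0"
        by (rule eventually_mono) simp
      then show ?case
        by (rule tendsto_eventually)
    qed
  qed auto
  moreover have "(\<integral>y. indicator B (\<beta> (g k) y) \<partial>\<nu>) = measure \<nu> B" for k
  proof -
    have "(\<integral>y. indicator B (\<beta> (g k) y) \<partial>\<nu>) = (\<integral>y. (indicator B y :: real) \<partial>distr \<nu> \<nu> (\<beta> (g k)))"
      using \<beta>_measurable[OF g] B(1) by (subst integral_distr) auto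
    then show ?thesis
      using B(1) sets.sets_into_space[OF B(1)] by (simp add: \<beta>_preserves[OF g] Int_absorb2)
  qed
  ultimately have "measure \<nu> B = 0"
    by (simp add: LIMSEQ_const_iff)
  then show False
    using B(2) by simp
qed

end

section \<open>Vanishing correlations and typical fibres\<close>

locale relatively_mixing_system = fibred_system G \<alpha> \<mu> \<beta> \<nu> \<pi> D \<B>
  for G :: "('g, 'c) monoid_scheme" (structure)
    and \<alpha> :: "'g \<Rightarrow> 'x::metric_space \<Rightarrow> 'x" and \<mu> :: "'x measure"
    and \<beta> :: "'g \<Rightarrow> 'y \<Rightarrow> 'y" and \<nu> :: "'y measure"
    and \<pi> :: "'x \<Rightarrow> 'y" and D :: "'y \<Rightarrow> 'x measure" and \<B> :: "'x set set" +
  assumes mixing: "f \<in> L_infinity \<mu> \<Longrightarrow> h \<in> L_infinity \<mu> \<Longrightarrow>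
      AE y in \<nu>. fibre_expectation D f y = 0 \<Longrightarrow> AE y in \<nu>. fibre_expectation D h y = 0 \<Longrightarrow>
      ((\<lambda>g. L2_norm \<nu> (fibre_expectation D (\<lambda>x. translate G \<alpha> g f x * h x))) \<longlongrightarrow> 0)
        (inf cofinite (principal (carrier G)))"
begin

lemma inverse_tends_to_infinity:
  assumes s: "inj s" "range s \<subseteq> carrier G"
  shows "filterlim (\<lambda>i. inv (s i)) (inf cofinite (principal (carrier G))) sequentially"
proof -
  have "inj (\<lambda>i. inv (s i))"
  proof (rule injI)
    fix i j
    assume "inv (s i) = inv (s j)"
    then have "s i = s j"
      using s(2) inv_inv by (metis range_subsetD)
    then show "i = j"
      using s(1) by (simp add: inj_eq)
  qed
  have "filterlim (\<lambda>i. inv (s i)) cofinite sequentially"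
    unfolding filterlim_iff
  proof (intro allI impI)
    fix P :: "'g \<Rightarrow> bool"
    assume "eventually P cofinite"
    then have "finite ((\<lambda>i. inv (s i)) -` {g. \<not> P g})"
      using \<open>inj (\<lambda>i. inv (s i))\<close> by (intro finite_vimageI) (simp add: eventually_cofinite)
    then show "\<forall>\<^sub>F i in sequentially. P (inv (s i))"
      by (simp add: eventually_cofinite vimage_def flip: cofinite_eq_sequentially)
  qed
  moreover have "filterlim (\<lambda>i. inv (s i)) (principal (carrier G)) sequentially"
    using s(2) by (auto simp: filterlim_principal intro!: always_eventually)
  ultimately show ?thesis
    by (rule filterlim_inf[THEN iffD2, OF conjI])
qed

text \<open>Mixing is applied along the inverses \<open>inv (s i)\<close>, because \<^const>\<open>translate\<close> composes a
  function with the inverse of the group element.\<close>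

lemma correlations_vanish:
  assumes s: "inj s" "range s \<subseteq> carrier G" and U: "U \<in> sets borel" and V: "V \<in> sets borel"
  shows "(\<lambda>i. \<integral>y. (fibre_correlation (s i) U V y)\<^sup>2 \<partial>\<nu>) \<longlonglongrightarrow> 0"
proof -
  define F where "F g = fibre_expectation D (\<lambda>x. translate G \<alpha> g (centred V) x * centred U x)" for g
  have "((\<lambda>g. L2_norm \<nu> (F g)) \<longlongrightarrow> 0) (inf cofinite (principal (carrier G)))"
    unfolding F_def using U V
    by (intro mixing centred_in_L_infinity fibre_expectation_centred)
  then have "(\<lambda>i. L2_norm \<nu> (F (inv (s i)))) \<longlonglongrightarrow> 0"
    using inverse_tends_to_infinity[OF s] by (rule filterlim_compose)
  then have "(\<lambda>i. (L2_norm \<nu> (F (inv (s i))))\<^sup>2) \<longlonglongrightarrow> 0\<^sup>2"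
    by (rule tendsto_power)
  moreover have "(L2_norm \<nu> (F (inv (s i))))\<^sup>2 = (\<integral>y. (fibre_correlation (s i) U V y)\<^sup>2 \<partial>\<nu>)" for i
  proof -
    have g: "s i \<in> carrier G"
      using s(2) by auto
    have "(\<lambda>x. translate G \<alpha> (inv (s i)) (centred V) x * centred U x) \<in> borel_measurable \<mu>"
      using measurable_compose[OF \<alpha>_measurable[OF g] centred_measurable[OF V]]
        centred_measurable[OF U] g
      unfolding translate_def by (intro borel_measurable_times) simp_all
    then have "F (inv (s i)) \<in> borel_measurable \<nu>"
      unfolding F_def fibre_expectation_def
      by (intro measurable_compose[OF D_measurable] integral_measurable_subprob_algebra)
    moreover have "AE y in \<nu>. F (inv (s i)) y = fibre_correlation (s i) U V y"
      unfolding F_def by (rule fibre_expectation_translate_centred[OF g U V])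
    ultimately have "(\<integral>y. (F (inv (s i)) y)\<^sup>2 \<partial>\<nu>) = (\<integral>y. (fibre_correlation (s i) U V y)\<^sup>2 \<partial>\<nu>)"
      using fibre_correlation_measurable[OF g U V]
      by (intro integral_cong_AE borel_measurable_power) (auto elim!: eventually_mono)
    then show ?thesis
      by (simp add: L2_norm_def)
  qed
  ultimately show ?thesis
    by simp
qed

lemma typical_fibres_independent:
  fixes s :: "nat \<Rightarrow> 'g"
  assumes s: "inj s" "range s \<subseteq> carrier G"
  shows "\<exists>r. strict_mono r \<and> (AE y in \<nu>.
    asymptotically_independent (D y) \<B> (\<lambda>k. \<alpha> (s (r k))) \<and>
    (\<forall>k. \<forall>V\<in>\<B>. measure (D (\<beta> (s (r k)) y)) V = measure (D y) (\<alpha> (s (r k)) -` V)))"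
proof -
  have sG: "s i \<in> carrier G" for i
    using s(2) by auto
  have base_borel: "V \<in> sets borel" if "V \<in> \<B>" for V
    using base_open[OF that] by simp
  define f where "f p i y = (fibre_correlation (s i) (fst p) (snd p) y)\<^sup>2" for p i y
  have "\<exists>r. strict_mono r \<and> (AE y in \<nu>. \<forall>p\<in>\<B> \<times> \<B>. (\<lambda>k. f p (r k) y) \<longlonglongrightarrow> 0)"
  proof (rule \<nu>.common_AE_subsequence)
    show "countable (\<B> \<times> \<B>)"
      using countable_base by simp
    fix p i
    assume p: "p \<in> \<B> \<times> \<B>"
    then have p_borel: "fst p \<in> sets borel" "snd p \<in> sets borel"
      by (auto intro: base_borel)
    show "f p i \<in> borel_measurable \<nu>"
      unfolding f_def using fibre_correlation_measurable[OF sG p_borel] by (rule borel_measurable_power)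
    show "0 \<le> f p i y \<and> f p i y \<le> 1" if "y \<in> space \<nu>" for y
      using fibre_correlation_bound[OF that, of "s i" "fst p" "snd p"]
      by (simp add: f_def abs_square_le_1)
    show "(\<lambda>i. \<integral>y. f p i y \<partial>\<nu>) \<longlonglongrightarrow> 0"
      unfolding f_def by (rule correlations_vanish[OF s p_borel])
  qed
  then obtain r where r: "strict_mono r"
      "AE y in \<nu>. \<forall>p\<in>\<B> \<times> \<B>. (\<lambda>k. f p (r k) y) \<longlonglongrightarrow> 0"
    by blast
  have "AE y in \<nu>. \<forall>k. \<forall>V\<in>\<B>. measure (D (\<beta> (s (r k)) y)) V = measure (D y) (\<alpha> (s (r k)) -` V)"
    using fibre_measures_equivariant[OF sG] base_borel countable_base
    by (simp add: AE_all_countable AE_ball_countable)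
  then have "AE y in \<nu>. asymptotically_independent (D y) \<B> (\<lambda>k. \<alpha> (s (r k))) \<and>
      (\<forall>k. \<forall>V\<in>\<B>. measure (D (\<beta> (s (r k)) y)) V = measure (D y) (\<alpha> (s (r k)) -` V))"
    using r(2) AE_space
  proof eventually_elim
    case (elim y)
    interpret Dy: prob_space "D y"
      using prob_space_D elim(3) .
    have "asymptotically_independent (D y) \<B> (\<lambda>k. \<alpha> (s (r k)))"
    proof
      show "sets (D y) = sets borel"
        using sets_D elim(3) .
      show "compact (UNIV :: 'x set)"
        by (rule compact_space)
      show "countable \<B>"
        by (rule countable_base)
      show "continuous_on UNIV (\<alpha> (s (r k)))" for k
        by (rule \<alpha>_continuous[OF sG])
      fix U V
      assume UV: "U \<in> \<B>" "V \<in> \<B>"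
      then have "(\<lambda>k. (fibre_correlation (s (r k)) U V y)\<^sup>2) \<longlonglongrightarrow> 0"
        using elim(2) by (auto simp: f_def)
      then have "(\<lambda>k. sqrt ((fibre_correlation (s (r k)) U V y)\<^sup>2)) \<longlonglongrightarrow> sqrt 0"
        by (rule tendsto_real_sqrt)
      then have "(\<lambda>k. fibre_correlation (s (r k)) U V y) \<longlonglongrightarrow> 0"
        by (simp add: tendsto_rabs_zero_iff)
      then show "(\<lambda>k. measure (D y) (U \<inter> \<alpha> (s (r k)) -` V)
          - measure (D y) U * measure (D y) (\<alpha> (s (r k)) -` V)) \<longlonglongrightarrow> 0"
        by (simp add: fibre_correlation_def)
    qed (use base_open base_nbhd in auto)
    then show ?case
      using elim(1) by blast
  qed
  with r(1) show ?thesis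
    by blast
qed

section \<open>Fibres with several separated pieces of mass\<close>

definition separated :: "'i set \<Rightarrow> ('i \<Rightarrow> 'x set) \<Rightarrow> real \<Rightarrow> bool" where
  "separated J V d \<longleftrightarrow> (\<forall>i\<in>J. \<forall>j\<in>J. i \<noteq> j \<longrightarrow> (\<forall>u\<in>V i. \<forall>v\<in>V j. dist u v > d))"

definition rich_fibres :: "'i set \<Rightarrow> ('i \<Rightarrow> 'x set) \<Rightarrow> real \<Rightarrow> 'y set" where
  "rich_fibres J V c = {y \<in> space \<nu>. \<forall>j\<in>J. measure (D y) (V j) \<ge> c}"

lemma rich_fibres_sets:
  assumes "finite J" and "\<And>j. j \<in> J \<Longrightarrow> V j \<in> \<B>"
  shows "rich_fibres J V c \<in> sets \<nu>"
  unfolding rich_fibres_def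
proof (rule sets.sets_Collect_finite_All[OF _ assms(1)])
  fix j
  assume "j \<in> J"
  then have "(\<lambda>y. measure (D y) (V j)) \<in> borel_measurable \<nu>"
    using assms(2) base_open by (intro measure_D_measurable) auto
  then show "{y \<in> space \<nu>. c \<le> measure (D y) (V j)} \<in> sets \<nu>"
    by measurable
qed

lemma borel_prob_base_D: "y \<in> space \<nu> \<Longrightarrow> borel_prob_base (D y) \<B>"
  unfolding borel_prob_base_def borel_prob_base_axioms_def
  using prob_space_D sets_D compact_space countable_base base_open base_nbhd by blast

text \<open>Since the exceptional set of fibres that are not typical is null, recurrence to the rich fibres yields fibres
  that are typical as well; equivariance then expresses the returns by the single measure \<open>D y\<close>.\<close>

lemma rich_fibres_recur:
  fixes s :: "nat \<Rightarrow> 'g"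
  assumes s: "inj s" "range s \<subseteq> carrier G" and J: "finite J" "\<And>j. j \<in> J \<Longrightarrow> V j \<in> \<B>"
    and rich: "measure \<nu> (rich_fibres J V c) > 0"
  shows "\<exists>r. strict_mono r \<and> \<not> (AE y in \<nu>. \<not>
    (asymptotically_independent (D y) \<B> (\<lambda>k. \<alpha> (s (r k))) \<and>
     (\<exists>\<^sub>F k in sequentially. \<forall>j\<in>J. measure (D y) (\<alpha> (s (r k)) -` V j) \<ge> c)))"
proof -
  obtain r where r: "strict_mono r" and typical: "AE y in \<nu>.
      asymptotically_independent (D y) \<B> (\<lambda>k. \<alpha> (s (r k))) \<and>
      (\<forall>k. \<forall>V\<in>\<B>. measure (D (\<beta> (s (r k)) y)) V = measure (D y) (\<alpha> (s (r k)) -` V))"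
    using typical_fibres_independent[OF s] by blast
  have "\<not> (AE y in \<nu>. \<not>
    (asymptotically_independent (D y) \<B> (\<lambda>k. \<alpha> (s (r k))) \<and>
     (\<exists>\<^sub>F k in sequentially. \<forall>j\<in>J. measure (D y) (\<alpha> (s (r k)) -` V j) \<ge> c)))"
  proof
    assume "AE y in \<nu>. \<not>
      (asymptotically_independent (D y) \<B> (\<lambda>k. \<alpha> (s (r k))) \<and>
       (\<exists>\<^sub>F k in sequentially. \<forall>j\<in>J. measure (D y) (\<alpha> (s (r k)) -` V j) \<ge> c))"
    with typical have "AE y in \<nu>. \<not> (\<exists>\<^sub>F k in sequentially. \<beta> (s (r k)) y \<in> rich_fibres J V c)"
    proof eventually_elim
      case (elim y)
      have "\<not> (\<exists>\<^sub>F k in sequentially. \<forall>j\<in>J. measure (D y) (\<alpha> (s (r k)) -` V j) \<ge> c)"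
        using elim by blast
      moreover have "\<forall>j\<in>J. measure (D y) (\<alpha> (s (r k)) -` V j) \<ge> c"
        if "\<beta> (s (r k)) y \<in> rich_fibres J V c" for k
        using that elim(1) J(2) by (auto simp: rich_fibres_def)
      ultimately show ?case
        using frequently_elim1[of "\<lambda>k. \<beta> (s (r k)) y \<in> rich_fibres J V c" sequentially
            "\<lambda>k. \<forall>j\<in>J. measure (D y) (\<alpha> (s (r k)) -` V j) \<ge> c"] by blast
    qed
    then show False
      using recurrence[of "\<lambda>k. s (r k)", OF _ rich_fibres_sets[OF J] rich] s(2) by auto
  qed
  with r show ?thesis
    by blast
qed

text \<open>Points of the support can be surrounded by separated base sets of positive mass. There are countably
  many choices for these sets and for bounds of the form \<open>1 / (n + 1)\<close> on distances and masses, so if all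
  of them occurred only on null sets, almost no fibre would have such points.\<close>

lemma rich_fibres_of_distinct_points:
  assumes J: "finite J" and points: "\<not> (AE y in \<nu>. \<not> (\<exists>x. inj_on x J \<and> x ` J \<subseteq> support (D y)))"
  shows "\<exists>V c d. (\<forall>j\<in>J. V j \<in> \<B>) \<and> c > 0 \<and> d > 0 \<and> separated J V d \<and>
    measure \<nu> (rich_fibres J V c) > 0"
proof (rule ccontr)
  assume contra: "\<not> ?thesis"
  define T where "T = {p \<in> (J \<rightarrow>\<^sub>E \<B>) \<times> (UNIV :: nat set). separated J (fst p) (1 / real (Suc (snd p)))}"
  have "countable ((J \<rightarrow>\<^sub>E \<B>) \<times> (UNIV :: nat set))"
    using countable_PiE[OF J] countable_base by (intro countable_SIGMA) auto
  then have "countable T"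
    by (rule countable_subset[rotated]) (auto simp: T_def)
  moreover have "AE y in \<nu>. y \<notin> rich_fibres J (fst p) (1 / real (Suc (snd p)))" if p: "p \<in> T" for p
  proof -
    have V: "fst p j \<in> \<B>" if "j \<in> J" for j
      using p that by (auto simp: T_def)
    have "separated J (fst p) (1 / real (Suc (snd p)))"
      using p by (auto simp: T_def)
    then have "\<not> measure \<nu> (rich_fibres J (fst p) (1 / real (Suc (snd p)))) > 0"
      using contra V by (metis of_nat_0_less_iff zero_less_Suc zero_less_divide_1_iff)
    then have "measure \<nu> (rich_fibres J (fst p) (1 / real (Suc (snd p)))) = 0"
      using measure_nonneg[of \<nu> "rich_fibres J (fst p) (1 / real (Suc (snd p)))"] by linarith
    then have "rich_fibres J (fst p) (1 / real (Suc (snd p))) \<in> null_sets \<nu>"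
      using rich_fibres_sets[OF J V] by (auto simp: null_sets_def \<nu>.emeasure_eq_measure)
    then show ?thesis
      by (rule AE_not_in)
  qed
  ultimately have "AE y in \<nu>. \<forall>p\<in>T. y \<notin> rich_fibres J (fst p) (1 / real (Suc (snd p)))"
    by (simp add: AE_ball_countable)
  then have "AE y in \<nu>. \<not> (\<exists>x. inj_on x J \<and> x ` J \<subseteq> support (D y))"
    using AE_space
  proof eventually_elim
    case (elim y)
    show ?case
    proof
      assume "\<exists>x. inj_on x J \<and> x ` J \<subseteq> support (D y)"
      then obtain x where x: "inj_on x J" "x ` J \<subseteq> support (D y)"
        by blast
      define P where "P = {p \<in> J \<times> J. fst p \<noteq> snd p}"
      have "\<exists>\<eta>>0. \<forall>p\<in>P. - dist (x (fst p)) (x (snd p)) + \<eta> \<le> 0"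
      proof (rule finite_strict_margin)
        show "finite P"
          unfolding P_def using J by simp
        show "- dist (x (fst p)) (x (snd p)) < 0" if "p \<in> P" for p
          using that inj_on_eq_iff[OF x(1), of "fst p" "snd p"] by (auto simp: P_def)
      qed
      then obtain \<eta> where \<eta>: "\<eta> > 0" "\<forall>p\<in>P. - dist (x (fst p)) (x (snd p)) + \<eta> \<le> 0"
        by blast
      have "\<forall>j. \<exists>V\<in>\<B>. x j \<in> V \<and> V \<subseteq> ball (x j) (\<eta> / 3)"
        using base_nbhd[of "ball _ (\<eta> / 3)"] \<eta>(1) by simp
      then obtain V where V: "\<And>j. V j \<in> \<B>" "\<And>j. x j \<in> V j" "\<And>j. V j \<subseteq> ball (x j) (\<eta> / 3)"
        by metis
      have mass: "measure (D y) (V j) > 0" if "j \<in> J" for j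
      proof (rule supportD)
        show "x j \<in> support (D y)"
          using x(2) that by blast
      qed (use V base_open in auto)
      have "\<exists>\<eta>>0. \<forall>j\<in>J. - measure (D y) (V j) + \<eta> \<le> 0"
        by (rule finite_strict_margin[OF J]) (simp add: mass)
      then obtain \<theta> where \<theta>: "\<theta> > 0" "\<And>j. j \<in> J \<Longrightarrow> measure (D y) (V j) \<ge> \<theta>"
        by fastforce
      obtain n where "1 / real (Suc n) < min (\<eta> / 3) \<theta>"
        using reals_Archimedean[of "min (\<eta> / 3) \<theta>"] \<eta>(1) \<theta>(1) by (auto simp: inverse_eq_divide)
      then have n: "1 / real (Suc n) \<le> \<eta> / 3" "1 / real (Suc n) \<le> \<theta>"
        by auto
      have "dist u v > 1 / real (Suc n)" if "i \<in> J" "j \<in> J" "i \<noteq> j" "u \<in> V i" "v \<in> V j" for i j u v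
      proof -
        have "dist (x i) (x j) \<ge> \<eta>"
          using \<eta>(2)[rule_format, of "(i, j)"] that by (simp add: P_def)
        moreover have "dist (x i) u < \<eta> / 3" "dist (x j) v < \<eta> / 3"
          using V(3)[of i] V(3)[of j] that by auto
        moreover have "dist (x i) (x j) \<le> dist (x i) u + dist u v + dist (x j) v"
          using dist_triangle[of "x i" "x j" u] dist_triangle[of u "x j" v] by (simp add: dist_commute)
        ultimately show ?thesis
          using n(1) by linarith
      qed
      then have "(restrict V J, n) \<in> T"
        using V(1) by (auto simp: T_def separated_def)
      then have "y \<notin> rich_fibres J (restrict V J) (1 / real (Suc n))"
        using elim(1) by fastforce
      moreover have "1 / real (Suc n) \<le> measure (D y) (V j)" if "j \<in> J" for j
        using \<theta>(2)[OF that] n(2) by linarith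
      ultimately show False
        using elim(2) unfolding rich_fibres_def by (simp del: of_nat_Suc)
    qed
  qed
  then show False
    using points by blast
qed

lemma perfect_of_two_pieces:
  assumes ind: "asymptotically_independent m \<B> T" and V: "V i \<in> \<B>" "V j \<in> \<B>" and "c > 0"
    and sep: "separated J V d" "i \<in> J" "j \<in> J" "i \<noteq> j" "d > 0"
    and mass: "\<exists>\<^sub>F k in sequentially. \<forall>j\<in>J. measure m (T k -` V j) \<ge> c"
    and x: "x \<in> support m"
  shows "x islimpt support m"
proof -
  interpret asymptotically_independent m \<B> T by fact
  define W where "W b = (if b then V i else V j)" for b
  have "V i \<inter> V j = {}"
    using sep unfolding separated_def by (metis dist_self disjoint_iff less_asym)
  moreover have "\<exists>\<^sub>F k in sequentially. \<forall>b. measure m (T k -` W b) \<ge> c"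
    using mass by (rule frequently_elim1) (use sep(2,3) in \<open>auto simp: W_def\<close>)
  ultimately show ?thesis
    using V \<open>c > 0\<close> x by (intro support_perfect[of W c]) (auto simp: W_def)
qed

text \<open>A bootstrap. On a set of positive measure the support of the fibre has at least two points. Returns to
  this set, along an arbitrary injective sequence, produce fibres with perfect and therefore infinite support.\<close>

lemma many_points_in_fibres:
  assumes infinite: "infinite (carrier G)" and not_dirac: "\<not> (AE y in \<nu>. \<exists>x. measure (D y) {x} = 1)"
    and J: "finite J"
  shows "\<not> (AE y in \<nu>. \<not> (\<exists>x. inj_on x J \<and> x ` J \<subseteq> support (D y)))"
proof -
  have two: "\<not> (AE y in \<nu>. \<not> (\<exists>x. inj_on x (UNIV :: bool set) \<and> x ` UNIV \<subseteq> support (D y)))"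
  proof
    assume "AE y in \<nu>. \<not> (\<exists>x. inj_on x (UNIV :: bool set) \<and> x ` UNIV \<subseteq> support (D y))"
    then have "AE y in \<nu>. \<exists>x. measure (D y) {x} = 1"
      using AE_space
    proof eventually_elim
      case (elim y)
      interpret borel_prob_base "D y" \<B>
        using borel_prob_base_D elim(2) .
      obtain p where p: "p \<in> support (D y)"
        using support_nonempty by blast
      have "q = p" if q: "q \<in> support (D y)" for q
      proof (rule ccontr)
        assume "q \<noteq> p"
        then have "inj_on (\<lambda>b. if b then p else q) UNIV"
          by (auto simp: inj_on_def)
        moreover have "(\<lambda>b. if b then p else q) ` UNIV \<subseteq> support (D y)"
          using p q by auto
        ultimately show False
          using elim(1) by blast
      qed
      then have "measure (D y) {p} = 1"
        by (intro support_singleton_dirac) auto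
      then show ?case
        by blast
    qed
    then show False
      using not_dirac by blast
  qed
  obtain V c d where V: "\<And>b. V b \<in> \<B>" and cd: "c > 0" "d > 0" and sep: "separated (UNIV :: bool set) V d"
    and rich: "measure \<nu> (rich_fibres UNIV V c) > 0"
    using rich_fibres_of_distinct_points[OF finite two] by auto
  obtain s :: "nat \<Rightarrow> 'g" where s: "inj s" "range s \<subseteq> carrier G"
    using infinite_countable_subset[OF infinite] by blast
  obtain r where r: "\<not> (AE y in \<nu>. \<not>
      (asymptotically_independent (D y) \<B> (\<lambda>k. \<alpha> (s (r k))) \<and>
       (\<exists>\<^sub>F k in sequentially. \<forall>b\<in>UNIV. measure (D y) (\<alpha> (s (r k)) -` V b) \<ge> c)))"
    using rich_fibres_recur[OF s finite V rich] by blast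
  show ?thesis
  proof
    assume none: "AE y in \<nu>. \<not> (\<exists>x. inj_on x J \<and> x ` J \<subseteq> support (D y))"
    have "AE y in \<nu>. \<not> (asymptotically_independent (D y) \<B> (\<lambda>k. \<alpha> (s (r k))) \<and>
       (\<exists>\<^sub>F k in sequentially. \<forall>b\<in>UNIV. measure (D y) (\<alpha> (s (r k)) -` V b) \<ge> c))"
      using none AE_space
    proof eventually_elim
      case (elim y)
      show ?case
      proof
        assume A: "asymptotically_independent (D y) \<B> (\<lambda>k. \<alpha> (s (r k))) \<and>
          (\<exists>\<^sub>F k in sequentially. \<forall>b\<in>UNIV. measure (D y) (\<alpha> (s (r k)) -` V b) \<ge> c)"
        interpret borel_prob_base "D y" \<B>
          using borel_prob_base_D elim(2) .
        obtain p where p: "p \<in> support (D y)"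
          using support_nonempty by blast
        have "p islimpt support (D y)"
          using perfect_of_two_pieces[of "D y" "\<lambda>k. \<alpha> (s (r k))" V True False c UNIV d p]
            A V cd sep p by simp
        then have "infinite (support (D y))"
          using islimpt_finite by blast
        then obtain F where F: "finite F" "card F = card J" "F \<subseteq> support (D y)"
          using infinite_arbitrarily_large by blast
        then obtain x where "bij_betw x J F"
          using finite_same_card_bij[OF J F(1)] by auto
        then show False
          using elim(1) F(3) by (auto simp: bij_betw_def)
      qed
    qed
    then show False
      using r by blast
  qed
qed

text \<open>The separation \<open>d\<close> comes from rich fibres that are fixed before the sequence is given; the
  sequence only decides which fibre \<open>y\<close> carries the Cantor set.\<close>

proposition cantor_sets_along_sequences:
  assumes infinite: "infinite (carrier G)" and not_dirac: "\<not> (AE y in \<nu>. \<exists>x. measure (D y) {x} = 1)"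
    and J: "finite J" "i\<^sub>0 \<in> J" "j\<^sub>0 \<in> J" "i\<^sub>0 \<noteq> j\<^sub>0"
  shows "\<exists>d>0. \<forall>s :: nat \<Rightarrow> 'g. inj s \<and> range s \<subseteq> carrier G \<longrightarrow>
    (\<exists>K. is_cantor_set K \<and> (\<forall>x. inj_on x J \<and> x ` J \<subseteq> K \<longrightarrow>
      (\<forall>e>0. \<exists>\<^sub>F i in sequentially. \<forall>a\<in>J. \<forall>b\<in>J. dist (\<alpha> (s i) (x a)) (\<alpha> (s i) (x b)) < e) \<and>
      (\<exists>\<^sub>F i in sequentially. \<forall>a\<in>J. \<forall>b\<in>J. a \<noteq> b \<longrightarrow>
        dist (\<alpha> (s i) (x a)) (\<alpha> (s i) (x b)) > d)))"
proof -
  obtain V c d where V: "\<And>j. j \<in> J \<Longrightarrow> V j \<in> \<B>" and cd: "c > 0" "d > 0" and sep: "separated J V d"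
    and rich: "measure \<nu> (rich_fibres J V c) > 0"
    using rich_fibres_of_distinct_points[OF J(1) many_points_in_fibres[OF infinite not_dirac J(1)]] by auto
  have "\<exists>K. is_cantor_set K \<and> (\<forall>x. inj_on x J \<and> x ` J \<subseteq> K \<longrightarrow>
      (\<forall>e>0. \<exists>\<^sub>F i in sequentially. \<forall>a\<in>J. \<forall>b\<in>J. dist (\<alpha> (s i) (x a)) (\<alpha> (s i) (x b)) < e) \<and>
      (\<exists>\<^sub>F i in sequentially. \<forall>a\<in>J. \<forall>b\<in>J. a \<noteq> b \<longrightarrow>
        dist (\<alpha> (s i) (x a)) (\<alpha> (s i) (x b)) > d))"
    if s: "inj s" "range s \<subseteq> carrier G" for s :: "nat \<Rightarrow> 'g"
  proof -
    obtain r where r: "strict_mono r" "\<not> (AE y in \<nu>. \<not>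
        (asymptotically_independent (D y) \<B> (\<lambda>k. \<alpha> (s (r k))) \<and>
         (\<exists>\<^sub>F k in sequentially. \<forall>j\<in>J. measure (D y) (\<alpha> (s (r k)) -` V j) \<ge> c)))"
      using rich_fibres_recur[OF s J(1) V rich] by blast
    have "\<exists>y. asymptotically_independent (D y) \<B> (\<lambda>k. \<alpha> (s (r k))) \<and>
        (\<exists>\<^sub>F k in sequentially. \<forall>j\<in>J. measure (D y) (\<alpha> (s (r k)) -` V j) \<ge> c)"
    proof (rule ccontr)
      assume "\<not> ?thesis"
      then have "\<not> (asymptotically_independent (D y) \<B> (\<lambda>k. \<alpha> (s (r k))) \<and>
          (\<exists>\<^sub>F k in sequentially. \<forall>j\<in>J. measure (D y) (\<alpha> (s (r k)) -` V j) \<ge> c))" for y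
        by blast
      from AE_I2[OF this] r(2) show False
        by contradiction
    qed
    then obtain y where ind: "asymptotically_independent (D y) \<B> (\<lambda>k. \<alpha> (s (r k)))"
      and mass: "\<exists>\<^sub>F k in sequentially. \<forall>j\<in>J. measure (D y) (\<alpha> (s (r k)) -` V j) \<ge> c"
      by blast
    interpret asymptotically_independent "D y" \<B> "\<lambda>k. \<alpha> (s (r k))"
      by (rule ind)
    have subsequence: "\<exists>\<^sub>F i in sequentially. P i" if "\<exists>\<^sub>F k in sequentially. P (r k)" for P
      using that seq_suble[OF r(1)] unfolding frequently_sequentially by (meson le_trans)
    have "\<exists>K. is_cantor_set K \<and> (\<forall>x. inj_on x J \<and> x ` J \<subseteq> K \<longrightarrow>
        (\<forall>e>0. \<exists>\<^sub>F k in sequentially. close_at J e k x) \<and> (\<exists>\<^sub>F k in sequentially. apart_at J d k x))"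
    proof (rule cantor_set_close_and_apart[OF J(1) V cd(1) mass])
      show "dist u v > d" if "i \<in> J" "j \<in> J" "i \<noteq> j" "u \<in> V i" "v \<in> V j" for i j u v
        using sep that unfolding separated_def by blast
      show "x islimpt support (D y)" if "x \<in> support (D y)" for x
        using perfect_of_two_pieces[OF ind V[OF J(2)] V[OF J(3)] cd(1) sep J(2,3,4) cd(2) mass that] .
    qed
    then obtain K where K: "is_cantor_set K" "\<And>x. inj_on x J \<and> x ` J \<subseteq> K \<Longrightarrow>
        (\<forall>e>0. \<exists>\<^sub>F k in sequentially. close_at J e k x) \<and> (\<exists>\<^sub>F k in sequentially. apart_at J d k x)"
      by blast
    show ?thesis
    proof (intro exI[of _ K] conjI allI impI K(1))
      fix x and e :: real
      assume x: "inj_on x J \<and> x ` J \<subseteq> K" and e: "e > 0"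
      show "\<exists>\<^sub>F i in sequentially. \<forall>a\<in>J. \<forall>b\<in>J. dist (\<alpha> (s i) (x a)) (\<alpha> (s i) (x b)) < e"
        by (rule subsequence) (use K(2)[OF x] e in \<open>simp add: close_at_def\<close>)
    next
      fix x
      assume x: "inj_on x J \<and> x ` J \<subseteq> K"
      show "\<exists>\<^sub>F i in sequentially. \<forall>a\<in>J. \<forall>b\<in>J. a \<noteq> b \<longrightarrow>
          dist (\<alpha> (s i) (x a)) (\<alpha> (s i) (x b)) > d"
        by (rule subsequence) (use K(2)[OF x] in \<open>simp add: apart_at_def\<close>)
    qed
  qed
  then show ?thesis
    using cd(2) by blast
qed

end

section \<open>Limits inferior and superior along recurring indices\<close>

lemma liminf_eq_0_if_frequently_small:
  fixes f :: "nat \<Rightarrow> real"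
  assumes nonneg: "\<And>i. 0 \<le> f i" and small: "\<And>e. e > 0 \<Longrightarrow> \<exists>\<^sub>F i in sequentially. f i < e"
  shows "liminf (\<lambda>i. ereal (f i)) = 0"
proof (rule antisym)
  show "0 \<le> liminf (\<lambda>i. ereal (f i))"
    by (rule Liminf_bounded) (simp add: nonneg)
  show "liminf (\<lambda>i. ereal (f i)) \<le> 0"
  proof (rule ccontr)
    assume "\<not> ?thesis"
    then obtain e where e: "0 < ereal e" "ereal e < liminf (\<lambda>i. ereal (f i))"
      using ereal_dense2[of 0 "liminf (\<lambda>i. ereal (f i))"] by (auto simp: not_le)
    have "\<forall>\<^sub>F i in sequentially. ereal e < ereal (f i)"
      using e(2) by (rule less_LiminfD)
    then have "\<forall>\<^sub>F i in sequentially. \<not> f i < e"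
      by (rule eventually_mono) simp
    then show False
      using small[of e] e(1) by (simp add: frequently_def)
  qed
qed

lemma limsup_ge_if_frequently_large:
  fixes f :: "nat \<Rightarrow> real"
  assumes "\<exists>\<^sub>F i in sequentially. f i > d"
  shows "ereal d \<le> limsup (\<lambda>i. ereal (f i))"
proof (rule ccontr)
  assume "\<not> ?thesis"
  then have "\<forall>\<^sub>F i in sequentially. ereal (f i) < ereal d"
    by (intro Limsup_lessD) simp
  then have "\<forall>\<^sub>F i in sequentially. \<not> f i > d"
    by (rule eventually_mono) simp
  then show False
    using assms by (simp add: frequently_def)
qed

lemma index_pairs_finite: "finite (index_pairs r)"
proof (rule finite_subset)
  show "index_pairs r \<subseteq> {1..r} \<times> {1..r}"
    by (auto simp: index_pairs_def)
qed simp

lemma index_pairs_nonempty: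
  assumes "r \<ge> 2"
  shows "index_pairs r \<noteq> {}"
proof -
  have "(1, 2) \<in> index_pairs r"
    using assms by (simp add: index_pairs_def)
  then show ?thesis
    by blast
qed

theorem proposition4p1:
  fixes G :: "('g, 'c) monoid_scheme"
    and \<alpha> :: "'g \<Rightarrow> 'x::metric_space \<Rightarrow> 'x" and \<mu> :: "'x measure"
    and \<beta> :: "'g \<Rightarrow> 'y \<Rightarrow> 'y" and \<nu> :: "'y measure"
    and \<pi> :: "'x \<Rightarrow> 'y" and r :: nat
  assumes "group G" and "countable (carrier G)" and "infinite (carrier G)"
    and "compact (UNIV :: 'x set)"
    and "\<forall>g\<in>carrier G. continuous_on UNIV (\<alpha> g)"
    and "sets \<mu> = sets borel"
    and "pmp_system G \<mu> \<alpha>" and "pmp_system G \<nu> \<beta>"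
    and "factor_map G \<mu> \<alpha> \<nu> \<beta> \<pi>"
    and "relatively_mixing G \<mu> \<alpha> \<nu> \<pi>"
    and "\<not> factor_isomorphism G \<mu> \<alpha> \<nu> \<beta> \<pi>"
    and "r \<ge> 2"
  shows "\<exists>\<delta>::real. \<delta> > 0 \<and>
    (\<forall>s :: nat \<Rightarrow> 'g. inj_on s {1..} \<and> s ` {1..} \<subseteq> carrier G \<longrightarrow>
      (\<exists>K :: 'x set. is_cantor_set K \<and>
        (\<forall>x :: nat \<Rightarrow> 'x. inj_on x {1..r} \<and> x ` {1..r} \<subseteq> K \<longrightarrow>
          liminf (\<lambda>i. ereal (MAX (a, b)\<in>index_pairs r. dist (\<alpha> (s i) (x a)) (\<alpha> (s i) (x b)))) = 0 \<and>
          limsup (\<lambda>i. ereal (MIN (a, b)\<in>index_pairs r. dist (\<alpha> (s i) (x a)) (\<alpha> (s i) (x b)))) > ereal \<delta>)))"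
proof -
  obtain D where D: "disintegration \<mu> \<nu> \<pi> D"
    and mixing: "\<And>f h. f \<in> L_infinity \<mu> \<Longrightarrow> h \<in> L_infinity \<mu> \<Longrightarrow>
      AE y in \<nu>. fibre_expectation D f y = 0 \<Longrightarrow> AE y in \<nu>. fibre_expectation D h y = 0 \<Longrightarrow>
      ((\<lambda>g. L2_norm \<nu> (fibre_expectation D (\<lambda>x. translate G \<alpha> g f x * h x))) \<longlongrightarrow> 0)
        (inf cofinite (principal (carrier G)))"
    using assms(10) unfolding relatively_mixing_def by blast
  obtain \<B> :: "'x set set" where \<B>: "countable \<B>" "\<And>V. V \<in> \<B> \<Longrightarrow> open V"
      "\<And>U x. open U \<Longrightarrow> x \<in> U \<Longrightarrow> \<exists>V\<in>\<B>. x \<in> V \<and> V \<subseteq> U"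
    using compact_metric_countable_base[OF assms(4)] by metis
  interpret group G
    by (rule assms(1))
  interpret relatively_mixing_system G \<alpha> \<mu> \<beta> \<nu> \<pi> D \<B>
  proof
    show "\<And>g. g \<in> carrier G \<Longrightarrow> continuous_on UNIV (\<alpha> g)"
      using assms(5) by blast
  qed (fact assms D mixing \<B>)+
  have not_dirac: "\<not> (AE y in \<nu>. \<exists>x. measure (D y) {x} = 1)"
    using dirac_fibres_imp_isomorphism assms(11) by blast
  have "(1::nat) \<in> {1..r}" "2 \<in> {1..r}" "(1::nat) \<noteq> 2"
    using assms(12) by auto
  from cantor_sets_along_sequences[OF assms(3) not_dirac finite_atLeastAtMost this]
  obtain d where d: "d > 0 \<and> (\<forall>s :: nat \<Rightarrow> 'g. inj s \<and> range s \<subseteq> carrier G \<longrightarrow>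
    (\<exists>K. is_cantor_set K \<and> (\<forall>x. inj_on x {1..r} \<and> x ` {1..r} \<subseteq> K \<longrightarrow>
      (\<forall>e>0. \<exists>\<^sub>F i in sequentially. \<forall>a\<in>{1..r}. \<forall>b\<in>{1..r}. dist (\<alpha> (s i) (x a)) (\<alpha> (s i) (x b)) < e) \<and>
      (\<exists>\<^sub>F i in sequentially. \<forall>a\<in>{1..r}. \<forall>b\<in>{1..r}. a \<noteq> b \<longrightarrow>
        dist (\<alpha> (s i) (x a)) (\<alpha> (s i) (x b)) > d))))"
    by (rule exE)
  note fin = index_pairs_finite[of r] and ne = index_pairs_nonempty[OF assms(12)]
  show ?thesis
  proof (intro exI[of _ "d / 2"] conjI allI impI)
    show "d / 2 > 0"
      using d by simp
    fix s :: "nat \<Rightarrow> 'g"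
    assume s: "inj_on s {1..} \<and> s ` {1..} \<subseteq> carrier G"
    \<comment> \<open>The sequence is only constrained from index 1 on, so it is shifted by one.\<close>
    have "inj (\<lambda>i. s (Suc i)) \<and> range (\<lambda>i. s (Suc i)) \<subseteq> carrier G"
      using s by (auto simp: inj_on_def)
    from d[THEN conjunct2, rule_format, OF this]
    obtain K where K: "is_cantor_set K \<and> (\<forall>x. inj_on x {1..r} \<and> x ` {1..r} \<subseteq> K \<longrightarrow>
      (\<forall>e>0. \<exists>\<^sub>F i in sequentially. \<forall>a\<in>{1..r}. \<forall>b\<in>{1..r}.
        dist (\<alpha> (s (Suc i)) (x a)) (\<alpha> (s (Suc i)) (x b)) < e) \<and>
      (\<exists>\<^sub>F i in sequentially. \<forall>a\<in>{1..r}. \<forall>b\<in>{1..r}. a \<noteq> b \<longrightarrow>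
        dist (\<alpha> (s (Suc i)) (x a)) (\<alpha> (s (Suc i)) (x b)) > d))"
      by (rule exE)
    have shift: "\<exists>\<^sub>F i in sequentially. P i" if "\<exists>\<^sub>F i in sequentially. P (Suc i)" for P
      using that eventually_sequentially_Suc[of "\<lambda>i. \<not> P i"] by (simp add: frequently_def)
    show "\<exists>K. is_cantor_set K \<and> (\<forall>x. inj_on x {1..r} \<and> x ` {1..r} \<subseteq> K \<longrightarrow>
      liminf (\<lambda>i. ereal (MAX (a, b)\<in>index_pairs r. dist (\<alpha> (s i) (x a)) (\<alpha> (s i) (x b)))) = 0 \<and>
      limsup (\<lambda>i. ereal (MIN (a, b)\<in>index_pairs r. dist (\<alpha> (s i) (x a)) (\<alpha> (s i) (x b)))) > ereal (d / 2))"
    proof (intro exI[of _ K] conjI allI impI)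
      show "is_cantor_set K"
        using K by (rule conjunct1)
    next
      fix x :: "nat \<Rightarrow> 'x"
      assume x: "inj_on x {1..r} \<and> x ` {1..r} \<subseteq> K"
      show "liminf (\<lambda>i. ereal (MAX (a, b)\<in>index_pairs r. dist (\<alpha> (s i) (x a)) (\<alpha> (s i) (x b)))) = 0"
      proof (rule liminf_eq_0_if_frequently_small)
        fix i
        obtain p where p: "p \<in> index_pairs r"
          using ne by blast
        have "0 \<le> (case p of (a, b) \<Rightarrow> dist (\<alpha> (s i) (x a)) (\<alpha> (s i) (x b)))"
          by (simp split: prod.split)
        also have "\<dots> \<le> (MAX (a, b)\<in>index_pairs r. dist (\<alpha> (s i) (x a)) (\<alpha> (s i) (x b)))"
          using fin p by (intro Max_ge) auto
        finally show "0 \<le> (MAX (a, b)\<in>index_pairs r. dist (\<alpha> (s i) (x a)) (\<alpha> (s i) (x b)))" .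
      next
        fix e :: real
        assume e: "e > 0"
        show "\<exists>\<^sub>F i in sequentially. (MAX (a, b)\<in>index_pairs r. dist (\<alpha> (s i) (x a)) (\<alpha> (s i) (x b))) < e"
        proof (rule shift, rule frequently_elim1[OF K[THEN conjunct2, rule_format, OF x, THEN conjunct1, rule_format, OF e]])
          fix i
          assume "\<forall>a\<in>{1..r}. \<forall>b\<in>{1..r}. dist (\<alpha> (s (Suc i)) (x a)) (\<alpha> (s (Suc i)) (x b)) < e"
          then show "(MAX (a, b)\<in>index_pairs r. dist (\<alpha> (s (Suc i)) (x a)) (\<alpha> (s (Suc i)) (x b))) < e"
            using fin ne by (subst Max_less_iff) (auto simp: index_pairs_def)
        qed
      qed
      have "ereal (d / 2) < ereal d"
        using d by simp
      also have "ereal d \<le> limsup (\<lambda>i. ereal (MIN (a, b)\<in>index_pairs r. dist (\<alpha> (s i) (x a)) (\<alpha> (s i) (x b))))"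
      proof (rule limsup_ge_if_frequently_large, rule shift, rule frequently_elim1[OF K[THEN conjunct2, rule_format, OF x, THEN conjunct2]])
        fix i
        assume "\<forall>a\<in>{1..r}. \<forall>b\<in>{1..r}. a \<noteq> b \<longrightarrow>
          dist (\<alpha> (s (Suc i)) (x a)) (\<alpha> (s (Suc i)) (x b)) > d"
        then show "d < (MIN (a, b)\<in>index_pairs r. dist (\<alpha> (s (Suc i)) (x a)) (\<alpha> (s (Suc i)) (x b)))"
          using fin ne by (subst Min_gr_iff) (auto simp: index_pairs_def)
      qed
      finally show "ereal (d / 2)
        < limsup (\<lambda>i. ereal (MIN (a, b)\<in>index_pairs r. dist (\<alpha> (s i) (x a)) (\<alpha> (s i) (x b))))" .
    qed
  qed
qed

end
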